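(* Let $X$ be a separable ANRU. Then for each uniform cover $C$ of $X$, $X$ is uniformly $C$-homotopy dominated by the geometric realization of a countable simplicial complex.
   Context: Uniform spaces are assumed Hausdorff (they need not be metrizable here); separable means having a countable dense subset. A uniform neighborhood of a subset $A$ of a uniform space $Z$ is a subset of $Z$ containing the star $\mathrm{st}(A,D)=\bigcup\{U\in D: U\cap A\ne\emptyset\}$ for some uniform cover $D$ of $Z$. A uniform space $X$ is an ANRU (in the sense of Isbell) if for every uniform space $Z$ and every subspace $A\subset Z$, every uniformly continuous map $A\to X$ extends to a uniformly continuous map of some uniform neighborhood of $A$ in $Z$ into $X$. $X$ is uniformly $C$-homotopy dominated by a uniform space $Y$ if there exist uniformly continuous maps $u\colon X\to Y$ and $v\colon Y\to X$ and a uniformly continuous homotopy $H\colon X\times[0,1]\to X$ from $vu$ to $\mathrm{id}_X$ such that for each $x\in X$ the set $H(\{x\}\times[0,1])$ is contained in some element of $C$. Geometric realization: for a poset $P$, let $[0,1]^P$ be the set of all functions $P\to[0,1]$ with the metric $d(f,g)=\sup_{s\in P}|f(s)-g(s)|$. Each $p\in P$ is identified with the characteristic function of $\{q\in P: q\le p\}$. Then $|P|\subset[0,1]^P$ is the union of the convex hulls of all nonempty finite chains of $P$, with the induced uniformity. An (abstract) simplicial complex, all of whose simplices are finite, is identified with the poset of its nonempty simplices ordered by inclusion, and its geometric realization is that of this poset. *)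

theory Defs
  imports "HOL-Analysis.Analysis"
begin

section \<open>Uniform spaces as objects\<close>

text \<open>
  The class \<open>uniform_space\<close> attaches one uniformity to each type, whereas the definition of an
  ANRU quantifies over uniform spaces. As \<open>'a topology\<close> and \<open>'a metric\<close> do for
  the classes \<open>topological_space\<close> and \<open>metric_space\<close>, the type below makes uniform
  spaces with arbitrary carriers into objects; the axioms are those of the class, relativised to
  the carrier. The Hausdorff property is not part of the type.
\<close>

definition is_uniformity :: "'a set \<Rightarrow> ('a \<times> 'a) filter \<Rightarrow> bool" where
  "is_uniformity S F \<longleftrightarrow>
     F \<le> principal (S \<times> S) \<and>
     (\<forall>E. eventually E F \<longrightarrow>
        (\<forall>x\<in>S. E (x, x)) \<and>
        eventually (\<lambda>(x, y). E (y, x)) F \<and>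
        (\<exists>D. eventually D F \<and> (\<forall>x y z. D (x, y) \<longrightarrow> D (y, z) \<longrightarrow> E (x, z))))"

typedef 'a uniform_structure = "{(S :: 'a set, F). is_uniformity S F}"
  morphisms dest_uniform uniform_structure
proof -
  have "is_uniformity ({} :: 'a set) bot"
    by (auto simp: is_uniformity_def)
  then show ?thesis by blast
qed

definition uspace :: "'a uniform_structure \<Rightarrow> 'a set" where
  "uspace X = fst (dest_uniform X)"

definition entourages :: "'a uniform_structure \<Rightarrow> ('a \<times> 'a) filter" where
  "entourages X = snd (dest_uniform X)"

lemma is_uniformity_entourages: "is_uniformity (uspace X) (entourages X)"
  using dest_uniform[of X] by (auto simp: uspace_def entourages_def)

lemma
  assumes "is_uniformity S F"
  shows uspace_uniform_structure: "uspace (uniform_structure (S, F)) = S"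
    and entourages_uniform_structure: "entourages (uniform_structure (S, F)) = F"
  using assms by (simp_all add: uspace_def entourages_def uniform_structure_inverse)

definition utopology :: "'a uniform_structure \<Rightarrow> 'a topology" where
  "utopology X = topology (\<lambda>U. U \<subseteq> uspace X \<and>
     (\<forall>x\<in>U. eventually (\<lambda>(x', y). x' = x \<longrightarrow> y \<in> U) (entourages X)))"

definition uniform_cover :: "'a uniform_structure \<Rightarrow> 'a set set \<Rightarrow> bool" where
  "uniform_cover X C \<longleftrightarrow> \<Union>C = uspace X \<and>
     (\<exists>E. eventually E (entourages X) \<and> (\<forall>x\<in>uspace X. \<exists>U\<in>C. {y \<in> uspace X. E (x, y)} \<subseteq> U))"

definition uniformly_continuous ::
    "'a uniform_structure \<Rightarrow> 'b uniform_structure \<Rightarrow> ('a \<Rightarrow> 'b) \<Rightarrow> bool" where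
  "uniformly_continuous X Y f \<longleftrightarrow> f \<in> uspace X \<rightarrow> uspace Y \<and>
     (LIM (x, y) entourages X. (f x, f y) :> entourages Y)"

definition subuniform :: "'a uniform_structure \<Rightarrow> 'a set \<Rightarrow> 'a uniform_structure" where
  "subuniform X A = uniform_structure
     (uspace X \<inter> A, inf (entourages X) (principal (A \<times> A)))"

definition prod_uniform ::
    "'a uniform_structure \<Rightarrow> 'b uniform_structure \<Rightarrow> ('a \<times> 'b) uniform_structure" where
  "prod_uniform X Y = uniform_structure (uspace X \<times> uspace Y,
     filtermap (\<lambda>((x, x'), (y, y')). ((x, y), (x', y'))) (entourages X \<times>\<^sub>F entourages Y))"

definition uniform_of_metric :: "'a metric \<Rightarrow> 'a uniform_structure" where
  "uniform_of_metric m = uniform_structure (mspace m,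
     INF e\<in>{0<..}. principal {(x, y). x \<in> mspace m \<and> y \<in> mspace m \<and> mdist m x y < e})"

text \<open>The arguments of \<open>topology\<close> and \<open>uniform_structure\<close> above are legitimate:\<close>

lemma openin_utopology:
  "openin (utopology X) U \<longleftrightarrow> U \<subseteq> uspace X \<and>
     (\<forall>x\<in>U. eventually (\<lambda>(x', y). x' = x \<longrightarrow> y \<in> U) (entourages X))"
proof -
  have "istopology (\<lambda>U. U \<subseteq> uspace X \<and>
     (\<forall>x\<in>U. eventually (\<lambda>(x', y). x' = x \<longrightarrow> y \<in> U) (entourages X)))"
    unfolding istopology_def
  proof (intro conjI allI impI)
    fix U V
    assume U: "U \<subseteq> uspace X \<and> (\<forall>x\<in>U. eventually (\<lambda>(x', y). x' = x \<longrightarrow> y \<in> U) (entourages X))"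
      and V: "V \<subseteq> uspace X \<and> (\<forall>x\<in>V. eventually (\<lambda>(x', y). x' = x \<longrightarrow> y \<in> V) (entourages X))"
    from U show "U \<inter> V \<subseteq> uspace X" by blast
    show "\<forall>x\<in>U \<inter> V. eventually (\<lambda>(x', y). x' = x \<longrightarrow> y \<in> U \<inter> V) (entourages X)"
    proof
      fix x assume "x \<in> U \<inter> V"
      with U V have "eventually (\<lambda>(x', y). x' = x \<longrightarrow> y \<in> U) (entourages X)"
        and "eventually (\<lambda>(x', y). x' = x \<longrightarrow> y \<in> V) (entourages X)" by auto
      then show "eventually (\<lambda>(x', y). x' = x \<longrightarrow> y \<in> U \<inter> V) (entourages X)"
        by eventually_elim auto
    qed
  next
    fix K
    assume K: "\<forall>U\<in>K. U \<subseteq> uspace X \<and>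
      (\<forall>x\<in>U. eventually (\<lambda>(x', y). x' = x \<longrightarrow> y \<in> U) (entourages X))"
    then show "\<Union>K \<subseteq> uspace X" by blast
    show "\<forall>x\<in>\<Union>K. eventually (\<lambda>(x', y). x' = x \<longrightarrow> y \<in> \<Union>K) (entourages X)"
    proof
      fix x assume "x \<in> \<Union>K"
      then obtain U where "U \<in> K" "x \<in> U" by blast
      with K have "eventually (\<lambda>(x', y). x' = x \<longrightarrow> y \<in> U) (entourages X)" by blast
      then show "eventually (\<lambda>(x', y). x' = x \<longrightarrow> y \<in> \<Union>K) (entourages X)"
        by (rule eventually_mono) (use \<open>U \<in> K\<close> in auto)
    qed
  qed
  then show ?thesis
    by (simp add: utopology_def topology_inverse')
qed

lemma eventually_entourages_carrier:
  "eventually (\<lambda>(x, y). x \<in> uspace X \<and> y \<in> uspace X) (entourages X)"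
proof -
  have "entourages X \<le> principal (uspace X \<times> uspace X)"
    using is_uniformity_entourages[of X] by (simp add: is_uniformity_def)
  then show ?thesis
    by (auto simp: le_principal elim: eventually_mono)
qed

lemma topspace_utopology [simp]: "topspace (utopology X) = uspace X"
proof (rule antisym)
  have "openin (utopology X) (uspace X)"
    unfolding openin_utopology using eventually_entourages_carrier[of X]
    by (auto elim: eventually_mono)
  then show "uspace X \<subseteq> topspace (utopology X)"
    by (rule openin_subset)
  show "topspace (utopology X) \<subseteq> uspace X"
    using openin_topspace[of "utopology X"] unfolding openin_utopology by blast
qed

lemma is_uniformity_subuniform:
  "is_uniformity (uspace X \<inter> A) (inf (entourages X) (principal (A \<times> A)))"
  unfolding is_uniformity_def
proof (intro conjI allI impI)
  have "entourages X \<le> principal (uspace X \<times> uspace X)"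
    using is_uniformity_entourages[of X] by (simp add: is_uniformity_def)
  then show "inf (entourages X) (principal (A \<times> A)) \<le> principal ((uspace X \<inter> A) \<times> (uspace X \<inter> A))"
    by (auto simp: le_principal eventually_inf_principal elim: eventually_mono)
next
  fix E assume "eventually E (inf (entourages X) (principal (A \<times> A)))"
  then have E: "eventually (\<lambda>p. p \<in> A \<times> A \<longrightarrow> E p) (entourages X)"
    by (simp add: eventually_inf_principal)
  note * = is_uniformity_entourages[of X, unfolded is_uniformity_def, THEN conjunct2,
      rule_format, OF E]
  from * show "\<forall>x\<in>uspace X \<inter> A. E (x, x)" by auto
  from * show "eventually (\<lambda>(x, y). E (y, x)) (inf (entourages X) (principal (A \<times> A)))"
    by (auto simp: eventually_inf_principal elim: eventually_mono)
  from * obtain D where D: "eventually D (entourages X)"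
    "\<And>x y z. D (x, y) \<Longrightarrow> D (y, z) \<Longrightarrow> (x, z) \<in> A \<times> A \<longrightarrow> E (x, z)"
    by blast
  show "\<exists>D. eventually D (inf (entourages X) (principal (A \<times> A))) \<and>
          (\<forall>x y z. D (x, y) \<longrightarrow> D (y, z) \<longrightarrow> E (x, z))"
    using D by (intro exI[of _ "\<lambda>p. p \<in> A \<times> A \<and> D p"])
      (auto simp: eventually_inf_principal elim: eventually_mono)
qed

lemma uspace_subuniform [simp]: "uspace (subuniform X A) = uspace X \<inter> A"
  and entourages_subuniform [simp]:
    "entourages (subuniform X A) = inf (entourages X) (principal (A \<times> A))"
  by (simp_all add: subuniform_def is_uniformity_subuniform
      uspace_uniform_structure entourages_uniform_structure)

lemma is_uniformity_prod_uniform: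
  "is_uniformity (uspace X \<times> uspace Y)
     (filtermap (\<lambda>((x, x'), (y, y')). ((x, y), (x', y'))) (entourages X \<times>\<^sub>F entourages Y))"
  unfolding is_uniformity_def
proof (intro conjI allI impI)
  show "filtermap (\<lambda>((x, x'), (y, y')). ((x, y), (x', y'))) (entourages X \<times>\<^sub>F entourages Y)
        \<le> principal ((uspace X \<times> uspace Y) \<times> (uspace X \<times> uspace Y))"
    unfolding le_principal eventually_filtermap eventually_prod_filter
    using eventually_entourages_carrier[of X] eventually_entourages_carrier[of Y] by fastforce
next
  fix E assume "eventually E
    (filtermap (\<lambda>((x, x'), (y, y')). ((x, y), (x', y'))) (entourages X \<times>\<^sub>F entourages Y))"
  then obtain P Q where P: "eventually P (entourages X)" and Q: "eventually Q (entourages Y)"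
    and E: "\<And>x x' y y'. P (x, x') \<Longrightarrow> Q (y, y') \<Longrightarrow> E ((x, y), (x', y'))"
    unfolding eventually_filtermap eventually_prod_filter by (auto simp: split_beta')
  note *[simp] = eventually_filtermap eventually_prod_filter
  note P' = is_uniformity_entourages[of X, unfolded is_uniformity_def, THEN conjunct2,
      rule_format, OF P]
  note Q' = is_uniformity_entourages[of Y, unfolded is_uniformity_def, THEN conjunct2,
      rule_format, OF Q]
  show "\<forall>p\<in>uspace X \<times> uspace Y. E (p, p)"
    using P' Q' E by auto
  show "eventually (\<lambda>(p, q). E (q, p))
    (filtermap (\<lambda>((x, x'), (y, y')). ((x, y), (x', y'))) (entourages X \<times>\<^sub>F entourages Y))"
    unfolding * 
    by (rule exI[of _ "\<lambda>(x, y). P (y, x)"], rule exI[of _ "\<lambda>(x, y). Q (y, x)"])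
      (use P' Q' E in auto)
  from P' obtain P1 where P1: "eventually P1 (entourages X)"
    "\<And>x y z. P1 (x, y) \<Longrightarrow> P1 (y, z) \<Longrightarrow> P (x, z)" by blast
  from Q' obtain Q1 where Q1: "eventually Q1 (entourages Y)"
    "\<And>x y z. Q1 (x, y) \<Longrightarrow> Q1 (y, z) \<Longrightarrow> Q (x, z)" by blast
  show "\<exists>D. eventually D
      (filtermap (\<lambda>((x, x'), (y, y')). ((x, y), (x', y'))) (entourages X \<times>\<^sub>F entourages Y)) \<and>
    (\<forall>x y z. D (x, y) \<longrightarrow> D (y, z) \<longrightarrow> E (x, z))"
    by (rule exI[of _ "\<lambda>((x, y), (x', y')). P1 (x, x') \<and> Q1 (y, y')"])
      (use P1 Q1 E in auto)
qed

lemma uspace_prod_uniform [simp]: "uspace (prod_uniform X Y) = uspace X \<times> uspace Y"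
  and entourages_prod_uniform: "entourages (prod_uniform X Y) =
     filtermap (\<lambda>((x, x'), (y, y')). ((x, y), (x', y'))) (entourages X \<times>\<^sub>F entourages Y)"
  by (simp_all add: prod_uniform_def is_uniformity_prod_uniform
      uspace_uniform_structure entourages_uniform_structure)

lemma eventually_metric_entourages:
  "eventually E (INF e\<in>{0<..}. principal {(x, y). x \<in> mspace m \<and> y \<in> mspace m \<and> mdist m x y < e})
   \<longleftrightarrow> (\<exists>e>0. \<forall>x\<in>mspace m. \<forall>y\<in>mspace m. mdist m x y < e \<longrightarrow> E (x, y))"
proof (subst eventually_INF_base, goal_cases)
  case 1 show ?case by (auto intro: exI[of _ 1])
next
  case (2 a b) then show ?case by (intro bexI[of _ "min a b"]) auto
next
  case 3 show ?case by (auto simp: eventually_principal Bex_def)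
qed

lemma is_uniformity_metric:
  "is_uniformity (mspace m)
     (INF e\<in>{0<..}. principal {(x, y). x \<in> mspace m \<and> y \<in> mspace m \<and> mdist m x y < e})"
  unfolding is_uniformity_def eventually_metric_entourages le_principal
proof (intro conjI allI impI)
  fix E assume "\<exists>e>0. \<forall>x\<in>mspace m. \<forall>y\<in>mspace m. mdist m x y < e \<longrightarrow> E (x, y)"
  then obtain e where e: "e > 0" "\<And>x y. x \<in> mspace m \<Longrightarrow> y \<in> mspace m \<Longrightarrow> mdist m x y < e \<Longrightarrow> E (x, y)"
    by blast
  show "\<forall>x\<in>mspace m. E (x, x)" using e by (metis mdist_zero)
  show "\<exists>e>0. \<forall>x\<in>mspace m. \<forall>y\<in>mspace m. mdist m x y < e \<longrightarrow> (case (x, y) of (x, y) \<Rightarrow> E (y, x))"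
    using e by (auto simp: mdist_commute)
  show "\<exists>D. (\<exists>e>0. \<forall>x\<in>mspace m. \<forall>y\<in>mspace m. mdist m x y < e \<longrightarrow> D (x, y)) \<and>
           (\<forall>x y z. D (x, y) \<longrightarrow> D (y, z) \<longrightarrow> E (x, z))"
  proof (intro exI[of _ "\<lambda>(x, y). x \<in> mspace m \<and> y \<in> mspace m \<and> mdist m x y < e/2"] conjI allI impI)
    show "\<exists>e'>0. \<forall>x\<in>mspace m. \<forall>y\<in>mspace m. mdist m x y < e' \<longrightarrow>
        (case (x, y) of (x, y) \<Rightarrow> x \<in> mspace m \<and> y \<in> mspace m \<and> mdist m x y < e/2)"
      using e by (intro exI[of _ "e/2"]) auto
    fix x y z
    assume "case (x, y) of (x, y) \<Rightarrow> x \<in> mspace m \<and> y \<in> mspace m \<and> mdist m x y < e/2"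
      "case (y, z) of (x, y) \<Rightarrow> x \<in> mspace m \<and> y \<in> mspace m \<and> mdist m x y < e/2"
    then show "E (x, z)"
      using mdist_triangle[of x m y z] by (intro e) auto
  qed
qed (auto intro: exI[of _ 1])

lemma uspace_uniform_of_metric [simp]: "uspace (uniform_of_metric m) = mspace m"
  and entourages_uniform_of_metric: "entourages (uniform_of_metric m) =
     (INF e\<in>{0<..}. principal {(x, y). x \<in> mspace m \<and> y \<in> mspace m \<and> mdist m x y < e})"
  by (simp_all add: uniform_of_metric_def is_uniformity_metric
      uspace_uniform_structure entourages_uniform_structure)


section \<open>Absolute neighborhood retracts of uniform spaces\<close>

definition star :: "'a set \<Rightarrow> 'a set set \<Rightarrow> 'a set" where
  "star A D = \<Union>{U \<in> D. U \<inter> A \<noteq> {}}"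

definition uniform_neighborhood :: "'a uniform_structure \<Rightarrow> 'a set \<Rightarrow> 'a set \<Rightarrow> bool" where
  "uniform_neighborhood Z A N \<longleftrightarrow> N \<subseteq> uspace Z \<and> (\<exists>D. uniform_cover Z D \<and> star A D \<subseteq> N)"

definition extends_to_uniform_neighborhood ::
    "'a uniform_structure \<Rightarrow> 'z uniform_structure \<Rightarrow> 'z set \<Rightarrow> ('z \<Rightarrow> 'a) \<Rightarrow> bool" where
  "extends_to_uniform_neighborhood X Z A f \<longleftrightarrow>
     (\<exists>N g. uniform_neighborhood Z A N \<and> uniformly_continuous (subuniform Z N) X g \<and>
            (\<forall>a\<in>A. g a = f a))"

text \<open>
  A formula of HOL cannot quantify over the type of points of \<open>Z\<close>, so the test spaces \<open>Z\<close>
  are taken on the subsets of one type that is large enough for \<open>X\<close>. Nothing is lost: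
  \<open>ANRU_extends\<close> below derives the extension property for test spaces over every type.
\<close>

type_synonym 'a test_point = "('a \<Rightarrow> 'a \<Rightarrow> real) \<times> 'a \<Rightarrow> real"

definition ANRU :: "'a uniform_structure \<Rightarrow> bool" where
  "ANRU X \<longleftrightarrow> Hausdorff_space (utopology X) \<and>
     (\<forall>(Z :: 'a test_point uniform_structure) A f.
        Hausdorff_space (utopology Z) \<and> A \<subseteq> uspace Z \<and> uniformly_continuous (subuniform Z A) X f
        \<longrightarrow> extends_to_uniform_neighborhood X Z A f)"

text \<open>
  Towards \<open>ANRU_extends\<close>: a sequence of entourages is controlled by one bounded uniform
  pseudometric; consequently every Hausdorff uniform space embeds in a space of functions that is
  injective for uniformly continuous maps.
\<close>

lemma entourage_refl: "eventually E (entourages X) \<Longrightarrow> x \<in> uspace X \<Longrightarrow> E (x, x)"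
  using is_uniformity_entourages[of X] unfolding is_uniformity_def by blast

lemma entourage_cube_root:
  assumes "eventually E (entourages X)"
  obtains D where "eventually D (entourages X)" "\<And>x y. D (x, y) \<Longrightarrow> D (y, x)"
    "\<And>t u v w. D (t, u) \<Longrightarrow> D (u, v) \<Longrightarrow> D (v, w) \<Longrightarrow> E (t, w)"
proof -
  note ax = is_uniformity_entourages[of X, unfolded is_uniformity_def, THEN conjunct2, rule_format]
  obtain D1 where D1: "eventually D1 (entourages X)"
    "\<And>x y z. D1 (x, y) \<Longrightarrow> D1 (y, z) \<Longrightarrow> E (x, z)"
    using ax[OF assms] by blast
  obtain D2 where D2: "eventually D2 (entourages X)"
    "\<And>x y z. D2 (x, y) \<Longrightarrow> D2 (y, z) \<Longrightarrow> D1 (x, z)"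
    using ax[OF D1(1)] by blast
  have D2': "eventually (\<lambda>(x, y). D2 (y, x)) (entourages X)"
    using ax[OF D2(1)] by blast
  let ?D = "\<lambda>p. D2 p \<and> (case p of (x, y) \<Rightarrow> D2 (y, x)) \<and> (case p of (x, y) \<Rightarrow> x \<in> uspace X \<and> y \<in> uspace X)"
  have "eventually ?D (entourages X)"
    by (intro eventually_conj D2(1) D2' eventually_entourages_carrier)
  moreover have "E (t, w)" if "?D (t, u)" "?D (u, v)" "?D (v, w)" for t u v w
  proof -
    have "D1 (t, v)" using that D2(2) by auto
    moreover have "D1 (v, w)"
      using that D2(2)[of v w w] entourage_refl[OF D2(1), of w] by auto
    ultimately show ?thesis by (rule D1(2))
  qed
  ultimately show ?thesis by (intro that[of ?D]) auto
qed

inductive path_sum :: "'a set \<Rightarrow> ('a \<Rightarrow> 'a \<Rightarrow> real) \<Rightarrow> nat \<Rightarrow> 'a \<Rightarrow> 'a \<Rightarrow> real \<Rightarrow> bool"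
  for S f where
  path_sum_Nil: "x \<in> S \<Longrightarrow> path_sum S f 0 x x 0"
| path_sum_Cons: "x \<in> S \<Longrightarrow> path_sum S f n y z s \<Longrightarrow> path_sum S f (Suc n) x z (f x y + s)"

lemma path_sum_in: "path_sum S f n x y s \<Longrightarrow> x \<in> S \<and> y \<in> S"
  by (induction rule: path_sum.induct) auto

lemma path_sum_single: "x \<in> S \<Longrightarrow> y \<in> S \<Longrightarrow> path_sum S f (Suc 0) x y (f x y)"
  using path_sum_Cons[OF _ path_sum_Nil, of x S y f] by simp

lemma path_sum_append:
  "path_sum S f n x y s \<Longrightarrow> path_sum S f m y z t \<Longrightarrow> path_sum S f (n + m) x z (s + t)"
proof (induction rule: path_sum.induct)
  case (path_sum_Cons x n y w s)
  then show ?case using path_sum.path_sum_Cons[of x S f "n + m" y z "s + t"] by (simp add: add.assoc)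
qed auto

lemma path_sum_rev:
  assumes "\<And>x y. f x y = f y x"
  shows "path_sum S f n x y s \<Longrightarrow> path_sum S f n y x s"
proof (induction rule: path_sum.induct)
  case (path_sum_Cons x n y z s)
  then show ?case
    using path_sum_append[OF path_sum_Cons.IH path_sum_single[of y S x f]]
      path_sum_in[OF path_sum_Cons.IH] assms[of y x] by (simp add: add.commute)
qed (rule path_sum_Nil)

lemma path_sum_nonneg:
  "path_sum S f n x y s \<Longrightarrow> (\<And>x y. 0 \<le> f x y) \<Longrightarrow> 0 \<le> s"
  by (induction rule: path_sum.induct) auto

lemma path_sum_split:
  assumes "\<And>x y. 0 \<le> f x y"
  shows "path_sum S f (Suc n) x y s \<Longrightarrow> 0 \<le> t \<Longrightarrow> t \<le> s \<Longrightarrow>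
    \<exists>u v l m p q. path_sum S f l x u p \<and> path_sum S f m v y q \<and> l \<le> n \<and> m \<le> n \<and>
      p \<le> t \<and> q \<le> s - t \<and> s = p + f u v + q"
proof (induction n arbitrary: x s t)
  case 0
  from 0(1) obtain x' s' where *: "x \<in> S" "path_sum S f 0 x' y s'" "s = f x x' + s'"
    by (cases rule: path_sum.cases) auto
  from *(2) have **: "x' = y" "s' = 0" "y \<in> S" by (cases rule: path_sum.cases; simp)+
  show ?case
    by (rule exI[of _ x], rule exI[of _ y], rule exI[of _ 0], rule exI[of _ 0],
        rule exI[of _ 0], rule exI[of _ 0])
      (use * ** 0 in \<open>auto intro: path_sum_Nil\<close>)
next
  case (Suc n)
  from Suc.prems(1) obtain x' s' where *: "x \<in> S" "path_sum S f (Suc n) x' y s'" "s = f x x' + s'"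
    by (cases rule: path_sum.cases) auto
  show ?case
  proof (cases "f x x' \<le> t")
    case True
    with Suc.IH[OF *(2), of "t - f x x'"] Suc.prems *(3)
    obtain u v l m p q where h: "path_sum S f l x' u p" "path_sum S f m v y q" "l \<le> n" "m \<le> n"
      "p \<le> t - f x x'" "q \<le> s' - (t - f x x')" "s' = p + f u v + q" by auto
    show ?thesis
      by (rule exI[of _ u], rule exI[of _ v], rule exI[of _ "Suc l"], rule exI[of _ m],
          rule exI[of _ "f x x' + p"], rule exI[of _ q])
        (use h * in \<open>auto intro: path_sum_Cons\<close>)
  next
    case False
    show ?thesis
      by (rule exI[of _ x], rule exI[of _ x'], rule exI[of _ 0], rule exI[of _ "Suc n"],
          rule exI[of _ 0], rule exI[of _ s'])
        (use False * Suc.prems in \<open>auto intro: path_sum_Nil\<close>)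
  qed
qed

lemma path_sum_bound:
  assumes nonneg: "\<And>x y. 0 \<le> f x y" and refl: "\<And>x. x \<in> S \<Longrightarrow> f x x = 0"
    and quasi: "\<And>a t u v w. \<lbrakk>t \<in> S; u \<in> S; v \<in> S; w \<in> S; f t u \<le> a; f u v \<le> a; f v w \<le> a\<rbrakk>
      \<Longrightarrow> f t w \<le> 2 * a"
  shows "path_sum S f n x y s \<Longrightarrow> f x y \<le> 2 * s"
proof (induction n arbitrary: x y s rule: less_induct)
  case (less n)
  show ?case
  proof (cases n)
    case 0
    with less.prems have "x = y" "s = 0" "x \<in> S" by (cases rule: path_sum.cases; simp)+
    then show ?thesis using refl by simp
  next
    case (Suc k)
    have s: "0 \<le> s" using path_sum_nonneg[OF less.prems nonneg] .
    obtain u v l m p q where h: "path_sum S f l x u p" "path_sum S f m v y q" "l \<le> k" "m \<le> k"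
      "p \<le> s / 2" "q \<le> s - s / 2" "s = p + f u v + q"
      using path_sum_split[OF nonneg less.prems[unfolded Suc], of "s / 2"] s
      by (metis divide_nonneg_nonneg field_sum_of_halves le_add_same_cancel1 zero_le_numeral)
    have "f x u \<le> 2 * p" using less.IH[OF _ h(1)] h(3) Suc by simp
    then have "f x u \<le> s" using h(5) by linarith
    moreover have "f v y \<le> 2 * q" using less.IH[OF _ h(2)] h(4) Suc by simp
    then have "f v y \<le> s" using h(6) by linarith
    moreover have "f u v \<le> s"
      using h(7) path_sum_nonneg[OF h(1) nonneg] path_sum_nonneg[OF h(2) nonneg] by simp
    ultimately show ?thesis
      using path_sum_in[OF h(1)] path_sum_in[OF h(2)] by (intro quasi[of x u v y]) auto
  qed
qed

definition uniform_pseudometric :: "'a uniform_structure \<Rightarrow> ('a \<Rightarrow> 'a \<Rightarrow> real) \<Rightarrow> bool" where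
  "uniform_pseudometric X d \<longleftrightarrow>
     (\<forall>x\<in>uspace X. \<forall>y\<in>uspace X. 0 \<le> d x y \<and> d x y \<le> 1 \<and> d x y = d y x) \<and>
     (\<forall>x\<in>uspace X. d x x = 0) \<and>
     (\<forall>x\<in>uspace X. \<forall>y\<in>uspace X. \<forall>z\<in>uspace X. d x z \<le> d x y + d y z) \<and>
     (\<forall>e>0. eventually (\<lambda>(x, y). d x y < e) (entourages X))"

lemma uniform_pseudometric_exists:
  fixes X :: "'a uniform_structure" and W :: "nat \<Rightarrow> 'a \<times> 'a \<Rightarrow> bool"
  assumes W: "\<And>n. eventually (W n) (entourages X)"
  obtains d where "uniform_pseudometric X d"
    "\<And>n x y. x \<in> uspace X \<Longrightarrow> y \<in> uspace X \<Longrightarrow> d x y < 1 / 2 ^ Suc n \<Longrightarrow> W n (x, y)"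
proof -
  define S where "S = uspace X"
  define ok where "ok V \<longleftrightarrow> eventually V (entourages X) \<and> (\<forall>x y. V (x, y) \<longrightarrow> V (y, x))" for V
  have "\<exists>V. \<forall>n. (ok (V n) \<and> (n = 0 \<longrightarrow> V n = (\<lambda>_. True))) \<and>
      (\<forall>t u v w. V (Suc n) (t, u) \<longrightarrow> V (Suc n) (u, v) \<longrightarrow> V (Suc n) (v, w) \<longrightarrow>
         V n (t, w) \<and> W n (t, w))"
  proof (rule dependent_nat_choice)
    show "\<exists>V. ok V \<and> ((0::nat) = 0 \<longrightarrow> V = (\<lambda>_. True))" by (auto simp: ok_def)
    fix V and n :: nat
    assume "ok V \<and> (n = 0 \<longrightarrow> V = (\<lambda>_. True))"
    then have "eventually (\<lambda>p. V p \<and> W n p) (entourages X)"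
      using W by (simp add: ok_def eventually_conj)
    then obtain D where "eventually D (entourages X)" "\<And>x y. D (x, y) \<Longrightarrow> D (y, x)"
      "\<And>t u v w. D (t, u) \<Longrightarrow> D (u, v) \<Longrightarrow> D (v, w) \<Longrightarrow> V (t, w) \<and> W n (t, w)"
      by (rule entourage_cube_root) blast
    then show "\<exists>V'. (ok V' \<and> (Suc n = 0 \<longrightarrow> V' = (\<lambda>_. True))) \<and>
      (\<forall>t u v w. V' (t, u) \<longrightarrow> V' (u, v) \<longrightarrow> V' (v, w) \<longrightarrow> V (t, w) \<and> W n (t, w))"
      by (intro exI[of _ D]) (auto simp: ok_def)
  qed
  then obtain V where V: "\<And>n. eventually (V n) (entourages X)" "\<And>n x y. V n (x, y) \<Longrightarrow> V n (y, x)"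
    "V 0 = (\<lambda>_. True)"
    "\<And>n t u v w. V (Suc n) (t, u) \<Longrightarrow> V (Suc n) (u, v) \<Longrightarrow> V (Suc n) (v, w) \<Longrightarrow>
         V n (t, w) \<and> W n (t, w)"
    unfolding ok_def by metis
  have Vrefl: "V n (x, x)" if "x \<in> S" for n x
    using entourage_refl[OF V(1)] that by (simp add: S_def)
  have Vstep: "V n (x, y) \<and> W n (x, y)" if "V (Suc n) (x, y)" "y \<in> S" for n x y
    using V(4)[OF that(1) Vrefl Vrefl] that(2) by simp
  have Vmono: "V n (x, y)" if "n \<le> m" "V m (x, y)" "y \<in> S" for n m x y
    using that by (induction rule: dec_induct) (use Vstep in blast)+
  define f where "f x y = Inf {1 / 2 ^ n :: real | n. V n (x, y)}" for x y
  have ne: "{1 / 2 ^ n :: real | n. V n (x, y)} \<noteq> {}" for x y by (auto simp: V(3) intro: exI[of _ 0])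
  have bdd: "bdd_below {1 / 2 ^ n :: real | n. V n (x, y)}" for x y
    by (rule bdd_belowI[of _ 0]) auto
  have f_le: "f x y \<le> 1 / 2 ^ n" if "V n (x, y)" for n x y
    unfolding f_def by (rule cInf_lower[OF _ bdd]) (use that in auto)
  have f_less: "V (Suc n) (x, y)" if less: "f x y < 1 / 2 ^ n" and "y \<in> S" for n x y
  proof -
    obtain k where k: "V k (x, y)" "1 / 2 ^ k < (1 / 2 ^ n :: real)"
      using cInf_lessD[OF ne less[unfolded f_def]] by auto
    then have "Suc n \<le> k" by (simp add: divide_simps split: if_splits)
    then show ?thesis using k \<open>y \<in> S\<close> Vmono by blast
  qed
  have f_nonneg: "0 \<le> f x y" for x y unfolding f_def by (rule cInf_greatest[OF ne]) auto
  have f_sym: "f x y = f y x" for x y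
  proof -
    have "V n (x, y) = V n (y, x)" for n using V(2) by blast
    then show ?thesis unfolding f_def by simp
  qed
  have small: "a \<le> 0" if "\<And>n. a \<le> 1 / 2 ^ n" for a :: real
  proof (rule ccontr)
    assume "\<not> a \<le> 0"
    then obtain n where "(1 / 2) ^ n < a" using real_arch_pow_inv[of a "1/2"] by auto
    with that[of n] show False by (simp add: power_one_over)
  qed
  have f_refl: "f x x = 0" if "x \<in> S" for x
    using small[of "f x x"] f_le[OF Vrefl[OF that]] f_nonneg[of x x] by fastforce
  have f_le1: "f x y \<le> 1" for x y using f_le[of 0 x y] V(3) by simp
  have quasi: "f t w \<le> 2 * a" if S: "t \<in> S" "u \<in> S" "v \<in> S" "w \<in> S"
    and a: "f t u \<le> a" "f u v \<le> a" "f v w \<le> a" for a t u v w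
  proof -
    have *: "f t w \<le> 1 / 2 ^ n" if "a < 1 / 2 ^ n" for n
    proof -
      have "V (Suc n) (t, u)" "V (Suc n) (u, v)" "V (Suc n) (v, w)"
        using f_less S a that by force+
      then show ?thesis using V(4) f_le by blast
    qed
    have a0: "0 \<le> a" using f_nonneg[of t u] a by simp
    consider "a \<ge> 1" | "a = 0" | "0 < a" "a < 1" using a0 by linarith
    then show ?thesis
    proof cases
      case 1 then show ?thesis using f_le1[of t w] by linarith
    next
      case 2 then show ?thesis using small[of "f t w"] * by simp
    next
      case 3
      define m where "m = (LEAST m. 1 / 2 ^ m \<le> a)"
      obtain k where "(1 / 2) ^ k < a" using real_arch_pow_inv[of a "1/2"] 3 by auto
      then have ex: "1 / 2 ^ k \<le> a" by (simp add: power_one_over)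
      have m: "1 / 2 ^ m \<le> a" unfolding m_def using ex by (rule LeastI)
      then obtain j where j: "m = Suc j" using 3 by (cases m) auto
      have "\<not> 1 / 2 ^ j \<le> a" using not_less_Least[of j "\<lambda>m. 1 / 2 ^ m \<le> a"] j m_def by simp
      then have "f t w \<le> 1 / 2 ^ j" by (intro *) simp
      also have "\<dots> \<le> 2 * a" using m j by (simp add: field_simps)
      finally show ?thesis .
    qed
  qed
  define d where "d x y = Inf {s. \<exists>n. path_sum S f n x y s}" for x y
  have ne': "{s. \<exists>n. path_sum S f n x y s} \<noteq> {}" if "x \<in> S" "y \<in> S" for x y
    using path_sum_single[OF that] by blast
  have bdd': "bdd_below {s. \<exists>n. path_sum S f n x y s}" for x y
    by (rule bdd_belowI[of _ 0]) (use path_sum_nonneg[OF _ f_nonneg] in auto)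
  have d_le: "d x y \<le> s" if "path_sum S f n x y s" for n x y s
    unfolding d_def by (rule cInf_lower[OF _ bdd']) (use that in auto)
  have d_ge: "a \<le> d x y" if "x \<in> S" "y \<in> S" "\<And>n s. path_sum S f n x y s \<Longrightarrow> a \<le> s" for a x y
    unfolding d_def by (rule cInf_greatest[OF ne']) (use that in auto)
  have d_f: "d x y \<le> f x y" if "x \<in> S" "y \<in> S" for x y
    using d_le[OF path_sum_single[OF that]] .
  have f_d: "f x y / 2 \<le> d x y" if "x \<in> S" "y \<in> S" for x y
  proof (rule d_ge[OF that])
    fix n s assume "path_sum S f n x y s"
    then have "f x y \<le> 2 * s"
    proof (rule path_sum_bound[rotated -1])
      show "f t w \<le> 2 * a"
        if "t \<in> S" "u \<in> S" "v \<in> S" "w \<in> S" "f t u \<le> a" "f u v \<le> a" "f v w \<le> a"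
        for a t u v w using that by (rule quasi)
    qed (use f_nonneg f_refl in auto)
    then show "f x y / 2 \<le> s" by simp
  qed
  have "uniform_pseudometric X d"
    unfolding uniform_pseudometric_def S_def[symmetric]
  proof (intro conjI ballI allI impI)
    fix x y assume xy: "x \<in> S" "y \<in> S"
    show "0 \<le> d x y" using f_d[OF xy] f_nonneg[of x y] by simp
    show "d x y \<le> 1" using d_f[OF xy] f_le1[of x y] by simp
    have "path_sum S f n x y s = path_sum S f n y x s" for n s
      using path_sum_rev[of f] f_sym by blast
    then show "d x y = d y x" unfolding d_def by simp
  next
    fix x assume x: "x \<in> S"
    show "d x x = 0"
      using d_f[OF x x] f_d[OF x x] f_refl[OF x] by simp
  next
    fix x y z assume *: "x \<in> S" "y \<in> S" "z \<in> S"
    have "d x z - d y z \<le> d x y"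
    proof (rule d_ge[OF *(1,2)])
      fix n s assume s: "path_sum S f n x y s"
      have "d x z - s \<le> d y z"
      proof (rule d_ge[OF *(2,3)])
        fix m t assume "path_sum S f m y z t"
        from d_le[OF path_sum_append[OF s this]] show "d x z - s \<le> t" by simp
      qed
      then show "d x z - d y z \<le> s" by simp
    qed
    then show "d x z \<le> d x y + d y z" by simp
  next
    fix e :: real assume "e > 0"
    then obtain n where n: "(1 / 2) ^ n < e" using real_arch_pow_inv[of e "1/2"] by auto
    from V(1)[of n] eventually_entourages_carrier[of X]
    show "eventually (\<lambda>(x, y). d x y < e) (entourages X)"
    proof eventually_elim
      case (elim p)
      then show ?case
        using d_f f_le n by (cases p) (fastforce simp: S_def power_one_over)
    qed
  qed
  moreover have "W n (x, y)" if "x \<in> uspace X" "y \<in> uspace X" "d x y < 1 / 2 ^ Suc n" for n x y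
  proof -
    have "f x y < 1 / 2 ^ n" using f_d[of x y] that by (auto simp: S_def)
    then show ?thesis using f_less Vstep that by (auto simp: S_def)
  qed
  ultimately show ?thesis by (rule that)
qed

lemma uniformly_continuousD:
  "uniformly_continuous X Y f \<Longrightarrow> eventually E (entourages Y) \<Longrightarrow>
    eventually (\<lambda>(x, y). E (f x, f y)) (entourages X)"
  unfolding uniformly_continuous_def filterlim_iff by (auto simp: split_beta')

lemma uniformly_continuousI:
  assumes "f \<in> uspace X \<rightarrow> uspace Y"
    and "\<And>E. eventually E (entourages Y) \<Longrightarrow> eventually (\<lambda>(x, y). E (f x, f y)) (entourages X)"
  shows "uniformly_continuous X Y f"
  using assms unfolding uniformly_continuous_def filterlim_iff by (auto simp: split_beta')

lemma uniform_pseudometric_extension: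
  assumes d: "uniform_pseudometric X d" and f: "uniformly_continuous (subuniform Z A) X f"
    and A: "A \<subseteq> uspace Z" "A \<noteq> {}"
  shows "\<exists>F. (\<forall>z\<in>uspace Z. \<forall>y\<in>uspace X. F z y \<in> {0..1}) \<and>
    (\<forall>a\<in>A. \<forall>y\<in>uspace X. F a y = d (f a) y) \<and>
    (\<forall>e>0. eventually (\<lambda>(z, z'). \<forall>y\<in>uspace X. \<bar>F z y - F z' y\<bar> < e) (entourages Z))"
proof -
  have fA: "f a \<in> uspace X" if "a \<in> A" for a
    using f that A by (auto simp: uniformly_continuous_def)
  define W where "W n = (\<lambda>(a, b). a \<in> A \<longrightarrow> b \<in> A \<longrightarrow> d (f a) (f b) < 1 / 2 ^ n)" for n :: nat
  have "eventually (W n) (entourages Z)" for n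
  proof -
    have "eventually (\<lambda>(x, y). d x y < 1 / 2 ^ n) (entourages X)"
      using d by (simp add: uniform_pseudometric_def)
    from uniformly_continuousD[OF f this] show ?thesis
      by (auto simp: W_def eventually_inf_principal split_beta' elim: eventually_mono)
  qed
  then obtain r where r: "uniform_pseudometric Z r"
    and rW: "\<And>n x y. x \<in> uspace Z \<Longrightarrow> y \<in> uspace Z \<Longrightarrow> r x y < 1 / 2 ^ Suc n \<Longrightarrow> W n (x, y)"
    using uniform_pseudometric_exists by blast
  have r_props: "0 \<le> r x y" "r x y = r y x" if "x \<in> uspace Z" "y \<in> uspace Z" for x y
    using r that by (auto simp: uniform_pseudometric_def)
  have r_tri: "r x z \<le> r x y + r y z" if "x \<in> uspace Z" "y \<in> uspace Z" "z \<in> uspace Z" for x y z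
    using r that by (auto simp: uniform_pseudometric_def)
  have r_refl: "r x x = 0" if "x \<in> uspace Z" for x
    using r that by (auto simp: uniform_pseudometric_def)
  have d_props: "0 \<le> d x y" "d x y \<le> 1" "d x y = d y x" if "x \<in> uspace X" "y \<in> uspace X" for x y
    using d that by (auto simp: uniform_pseudometric_def)
  have d_tri: "d x z \<le> d x y + d y z" if "x \<in> uspace X" "y \<in> uspace X" "z \<in> uspace X" for x y z
    using d that by (auto simp: uniform_pseudometric_def)
  have d_r: "d (f a) (f b) \<le> 4 * r a b" if ab: "a \<in> A" "b \<in> A" for a b
  proof (rule ccontr)
    assume neg: "\<not> d (f a) (f b) \<le> 4 * r a b"
    have abZ: "a \<in> uspace Z" "b \<in> uspace Z" using ab A by auto
    have pos: "0 < d (f a) (f b)" using neg r_props(1)[OF abZ] by linarith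
    obtain k where k: "(1 / 2) ^ k < d (f a) (f b)"
      using real_arch_pow_inv[of "d (f a) (f b)" "1/2"] pos by auto
    define m where "m = (LEAST m. 1 / 2 ^ m < d (f a) (f b))"
    have "1 / 2 ^ k < d (f a) (f b)" using k by (simp add: power_one_over)
    then have m: "1 / 2 ^ m < d (f a) (f b)" unfolding m_def by (rule LeastI)
    then obtain j where j: "m = Suc j" using d_props(2)[of "f a" "f b"] fA ab by (cases m) auto
    have "\<not> 1 / 2 ^ j < d (f a) (f b)"
      using not_less_Least[of j "\<lambda>m. 1 / 2 ^ m < d (f a) (f b)"] j m_def by simp
    moreover have "\<not> r a b < 1 / 2 ^ Suc m"
      using rW[OF abZ, of m] m ab by (auto simp: W_def)
    moreover have "1 / 2 ^ j = 4 * (1 / 2 ^ Suc m :: real)" by (simp add: j)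
    ultimately show False using neg by linarith
  qed
  define G where "G z y = (INF a\<in>A. d (f a) y + 4 * r a z)" for z y
  have bdd: "bdd_below ((\<lambda>a. d (f a) y + 4 * r a z) ` A)" if "z \<in> uspace Z" "y \<in> uspace X" for z y
  proof (rule bdd_belowI2[of _ 0])
    fix a assume "a \<in> A"
    with that A show "0 \<le> d (f a) y + 4 * r a z"
      using d_props(1)[of "f a" y] r_props(1)[of a z] fA[of a] by auto
  qed
  have G_nonneg: "0 \<le> G z y" if "z \<in> uspace Z" "y \<in> uspace X" for z y
    unfolding G_def
  proof (rule cINF_greatest[OF A(2)])
    fix a assume "a \<in> A"
    with that A show "0 \<le> d (f a) y + 4 * r a z"
      using d_props(1)[of "f a" y] r_props(1)[of a z] fA[of a] by auto
  qed
  have G_A: "G b y = d (f b) y" if b: "b \<in> A" and y: "y \<in> uspace X" for b y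
  proof (rule antisym)
    have bZ: "b \<in> uspace Z" using A b by auto
    show "G b y \<le> d (f b) y"
      using cINF_lower[OF bdd[OF bZ y] b] r_refl[OF bZ] by (simp add: G_def)
    show "d (f b) y \<le> G b y" unfolding G_def
    proof (rule cINF_greatest[OF A(2)])
      fix a assume a: "a \<in> A"
      have "d (f b) y \<le> d (f b) (f a) + d (f a) y" using d_tri fA a b y by blast
      also have "d (f b) (f a) = d (f a) (f b)" using d_props(3) fA a b by blast
      finally show "d (f b) y \<le> d (f a) y + 4 * r a b" using d_r[OF a b] by simp
    qed
  qed
  have G_lip: "G z y \<le> G z' y + 4 * r z z'"
    if z: "z \<in> uspace Z" "z' \<in> uspace Z" and y: "y \<in> uspace X" for z z' y
  proof -
    have "G z y - 4 * r z z' \<le> G z' y" unfolding G_def[of z']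
    proof (rule cINF_greatest[OF A(2)])
      fix a assume a: "a \<in> A"
      have "G z y \<le> d (f a) y + 4 * r a z" unfolding G_def by (rule cINF_lower[OF bdd[OF z(1) y] a])
      also have "r a z \<le> r a z' + r z' z" using r_tri[of a z' z] a A z by auto
      also have "r z' z = r z z'" using r_props(2) z by blast
      finally show "G z y - 4 * r z z' \<le> d (f a) y + 4 * r a z'" by simp
    qed
    then show ?thesis by simp
  qed
  define F where "F z y = min 1 (G z y)" for z y
  have F_lip: "\<bar>F z y - F z' y\<bar> \<le> 4 * r z z'"
    if z: "z \<in> uspace Z" "z' \<in> uspace Z" and y: "y \<in> uspace X" for z z' y
    using G_lip[OF z y] G_lip[OF z(2,1) y] r_props[OF z] by (auto simp: F_def min_def)
  show ?thesis
  proof (intro exI[of _ F] conjI ballI allI impI)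
    fix z y assume "z \<in> uspace Z" "y \<in> uspace X"
    then show "F z y \<in> {0..1}" using G_nonneg by (auto simp: F_def)
  next
    fix a y assume "a \<in> A" "y \<in> uspace X"
    then show "F a y = d (f a) y" using G_A d_props(2) fA by (simp add: F_def)
  next
    fix e :: real assume "e > 0"
    then have "eventually (\<lambda>(x, y). r x y < e / 4) (entourages Z)"
      using r unfolding uniform_pseudometric_def by (meson divide_pos_pos zero_less_numeral)
    with eventually_entourages_carrier[of Z]
    show "eventually (\<lambda>(z, z'). \<forall>y\<in>uspace X. \<bar>F z y - F z' y\<bar> < e) (entourages Z)"
    proof eventually_elim
      case (elim p)
      then show ?case using F_lip[of "fst p" "snd p"] by (fastforce simp: split_beta')
    qed
  qed
qed

text \<open>
  A product, over all bounded uniform pseudometrics \<open>d\<close> of \<open>X\<close>, of copies of the cube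
  over the points of \<open>X\<close>.
\<close>

definition test_carrier :: "'a uniform_structure \<Rightarrow> 'a test_point set" where
  "test_carrier X = ({d. uniform_pseudometric X d} \<times> uspace X \<rightarrow>\<^sub>E {0..1})"

definition test_entourages :: "'a uniform_structure \<Rightarrow> ('a test_point \<times> 'a test_point) filter" where
  "test_entourages X = (INF (D, e)\<in>{(D, e). finite D \<and> D \<subseteq> {d. uniform_pseudometric X d} \<and> 0 < e}.
     principal {(q, r). q \<in> test_carrier X \<and> r \<in> test_carrier X \<and>
       (\<forall>d\<in>D. \<forall>y\<in>uspace X. \<bar>q (d, y) - r (d, y)\<bar> < e)})"

definition test_space :: "'a uniform_structure \<Rightarrow> 'a test_point uniform_structure" where
  "test_space X = uniform_structure (test_carrier X, test_entourages X)"

lemma eventually_test_entourages: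
  "eventually E (test_entourages X) \<longleftrightarrow>
    (\<exists>D e. finite D \<and> D \<subseteq> {d. uniform_pseudometric X d} \<and> 0 < e \<and>
      (\<forall>q\<in>test_carrier X. \<forall>r\<in>test_carrier X.
         (\<forall>d\<in>D. \<forall>y\<in>uspace X. \<bar>q (d, y) - r (d, y)\<bar> < e) \<longrightarrow> E (q, r)))"
  unfolding test_entourages_def
proof (subst eventually_INF_base, goal_cases)
  case 1
  have "({}, 1) \<in> {(D, e). finite D \<and> D \<subseteq> {d. uniform_pseudometric X d} \<and> 0 < (e :: real)}"
    by simp
  then show ?case by blast
next
  case (2 a b)
  obtain D1 e1 D2 e2 where *: "a = (D1, e1)" "b = (D2, e2)" by (cases a, cases b)
  show ?case using 2 unfolding * by (intro bexI[of _ "(D1 \<union> D2, min e1 e2)"]) auto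
next
  case 3
  show ?case
    unfolding Bex_def split_paired_Ex mem_Collect_eq prod.case eventually_principal
    by (simp add: Ball_def imp_conjL)
qed

lemma is_uniformity_test: "is_uniformity (test_carrier X) (test_entourages X)"
  unfolding is_uniformity_def le_principal
proof (intro conjI allI impI)
  show "eventually (\<lambda>x. x \<in> test_carrier X \<times> test_carrier X) (test_entourages X)"
    unfolding eventually_test_entourages by (intro exI[of _ "{}"] exI[of _ 1]) auto
  fix E assume "eventually E (test_entourages X)"
  then obtain D e where D: "finite D" "D \<subseteq> {d. uniform_pseudometric X d}" "0 < e"
    and E: "\<And>q r. \<lbrakk>q \<in> test_carrier X; r \<in> test_carrier X;
      \<forall>d\<in>D. \<forall>y\<in>uspace X. \<bar>q (d, y) - r (d, y)\<bar> < e\<rbrakk> \<Longrightarrow> E (q, r)"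
    unfolding eventually_test_entourages by blast
  show "\<forall>q\<in>test_carrier X. E (q, q)" using E D(3) by auto
  show "eventually (\<lambda>(q, r). E (r, q)) (test_entourages X)"
    unfolding eventually_test_entourages
  proof (intro exI[of _ D] exI[of _ e] conjI D ballI impI)
    fix q r assume "q \<in> test_carrier X" "r \<in> test_carrier X"
      "\<forall>d\<in>D. \<forall>y\<in>uspace X. \<bar>q (d, y) - r (d, y)\<bar> < e"
    then show "case (q, r) of (q, r) \<Rightarrow> E (r, q)"
      using E[of r q] by (simp add: abs_minus_commute)
  qed
  let ?D = "\<lambda>(q, r). q \<in> test_carrier X \<and> r \<in> test_carrier X \<and>
    (\<forall>d\<in>D. \<forall>y\<in>uspace X. \<bar>q (d, y) - r (d, y)\<bar> < e / 2)"
  show "\<exists>D. eventually D (test_entourages X) \<and> (\<forall>x y z. D (x, y) \<longrightarrow> D (y, z) \<longrightarrow> E (x, z))"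
  proof (intro exI[of _ ?D] conjI allI impI)
    show "eventually ?D (test_entourages X)"
      unfolding eventually_test_entourages by (intro exI[of _ D] exI[of _ "e/2"]) (use D in auto)
    fix x y z assume xy: "?D (x, y)" and yz: "?D (y, z)"
    show "E (x, z)"
    proof (rule E)
      show "\<forall>d\<in>D. \<forall>u\<in>uspace X. \<bar>x (d, u) - z (d, u)\<bar> < e"
      proof (intro ballI)
        fix d u assume "d \<in> D" "u \<in> uspace X"
        then have "\<bar>x (d, u) - y (d, u)\<bar> < e / 2" "\<bar>y (d, u) - z (d, u)\<bar> < e / 2"
          using xy yz by auto
        then show "\<bar>x (d, u) - z (d, u)\<bar> < e" by (simp add: abs_if split: if_splits)
      qed
    qed (use xy yz in auto)
  qed
qed

lemma uspace_test_space [simp]: "uspace (test_space X) = test_carrier X"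
  and entourages_test_space [simp]: "entourages (test_space X) = test_entourages X"
  by (simp_all add: test_space_def is_uniformity_test
      uspace_uniform_structure entourages_uniform_structure)

lemma Hausdorff_test_space: "Hausdorff_space (utopology (test_space X))"
  unfolding Hausdorff_space_def topspace_utopology uspace_test_space
proof (intro allI impI, elim conjE)
  fix q r assume q: "q \<in> test_carrier X" and r: "r \<in> test_carrier X" and "q \<noteq> r"
  obtain d y where dy: "uniform_pseudometric X d" "y \<in> uspace X" "q (d, y) \<noteq> r (d, y)"
  proof (rule ccontr)
    assume "\<not> thesis"
    with that have "\<And>p. p \<in> {d. uniform_pseudometric X d} \<times> uspace X \<Longrightarrow> q p = r p" by fastforce
    with q r have "q = r" unfolding test_carrier_def by (metis PiE_ext)
    with \<open>q \<noteq> r\<close> show False by simp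
  qed
  define \<delta> where "\<delta> = \<bar>q (d, y) - r (d, y)\<bar> / 2"
  define B where "B p = {s \<in> test_carrier X. \<bar>p (d, y) - s (d, y)\<bar> < \<delta>}" for p
  have \<delta>: "0 < \<delta>" using dy by (simp add: \<delta>_def)
  have "openin (utopology (test_space X)) (B p)" for p
    unfolding openin_utopology uspace_test_space entourages_test_space
  proof (intro conjI ballI)
    show "B p \<subseteq> test_carrier X" by (auto simp: B_def)
    fix s assume s: "s \<in> B p"
    show "eventually (\<lambda>(s', t). s' = s \<longrightarrow> t \<in> B p) (test_entourages X)"
      unfolding eventually_test_entourages
    proof (intro exI[of _ "{d}"] exI[of _ "\<delta> - \<bar>p (d, y) - s (d, y)\<bar>"] conjI ballI impI)
      fix s' t assume *: "t \<in> test_carrier X"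
        "\<forall>d'\<in>{d}. \<forall>y'\<in>uspace X. \<bar>s' (d', y') - t (d', y')\<bar> < \<delta> - \<bar>p (d, y) - s (d, y)\<bar>"
      then have "\<bar>s' (d, y) - t (d, y)\<bar> < \<delta> - \<bar>p (d, y) - s (d, y)\<bar>" using dy by blast
      with * show "case (s', t) of (s', t) \<Rightarrow> s' = s \<longrightarrow> t \<in> B p"
        by (auto simp: B_def)
    qed (use s dy in \<open>auto simp: B_def\<close>)
  qed
  moreover have "disjnt (B q) (B r)"
  proof -
    have False if "s \<in> B q" "s \<in> B r" for s
    proof -
      have "\<bar>q (d, y) - s (d, y)\<bar> < \<delta>" "\<bar>r (d, y) - s (d, y)\<bar> < \<delta>" using that by (auto simp: B_def)
      then show False unfolding \<delta>_def by (simp add: abs_if field_simps split: if_splits)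
    qed
    then show ?thesis by (auto simp: disjnt_def)
  qed
  ultimately show "\<exists>U V. openin (utopology (test_space X)) U \<and> openin (utopology (test_space X)) V \<and>
      q \<in> U \<and> r \<in> V \<and> disjnt U V"
    using \<delta> q r by (intro exI[of _ "B q"] exI[of _ "B r"]) (auto simp: B_def)
qed

lemma uniform_neighborhood_vimage:
  assumes F: "uniformly_continuous Z Q F" and N: "uniform_neighborhood Q B N" and "F ` A \<subseteq> B"
    and A: "A \<subseteq> uspace Z"
  shows "uniform_neighborhood Z A {z \<in> uspace Z. F z \<in> N}"
proof -
  obtain D where D: "uniform_cover Q D" "star B D \<subseteq> N"
    using N by (auto simp: uniform_neighborhood_def)
  obtain E where E: "eventually E (entourages Q)"
    "\<And>x. x \<in> uspace Q \<Longrightarrow> \<exists>U\<in>D. {y \<in> uspace Q. E (x, y)} \<subseteq> U"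
    using D by (auto simp: uniform_cover_def)
  have FQ: "F z \<in> uspace Q" if "z \<in> uspace Z" for z
    using F that by (auto simp: uniformly_continuous_def)
  define D' where "D' = (\<lambda>U. {z \<in> uspace Z. F z \<in> U}) ` D"
  have "uniform_cover Z D'"
    unfolding uniform_cover_def
  proof (intro conjI exI[of _ "\<lambda>(x, y). E (F x, F y)"] ballI)
    show "\<Union>D' = uspace Z" using FQ D(1) by (auto simp: D'_def uniform_cover_def)
    show "eventually (\<lambda>(x, y). E (F x, F y)) (entourages Z)"
      by (rule uniformly_continuousD[OF F E(1)])
    fix x assume x: "x \<in> uspace Z"
    obtain U where "U \<in> D" "{y \<in> uspace Q. E (F x, y)} \<subseteq> U" using E(2) FQ x by blast
    then show "\<exists>U\<in>D'. {y \<in> uspace Z. case (x, y) of (x, y) \<Rightarrow> E (F x, F y)} \<subseteq> U"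
      unfolding D'_def by (intro bexI[of _ "{z \<in> uspace Z. F z \<in> U}"]) (auto simp: FQ)
  qed
  moreover have "star A D' \<subseteq> {z \<in> uspace Z. F z \<in> N}"
  proof
    fix z assume "z \<in> star A D'"
    then obtain U a where "U \<in> D" "a \<in> A" "F a \<in> U" "z \<in> uspace Z" "F z \<in> U"
      by (auto simp: star_def D'_def)
    then have "F z \<in> star B D" using assms(3) by (auto simp: star_def)
    with D \<open>z \<in> uspace Z\<close> show "z \<in> {z \<in> uspace Z. F z \<in> N}" by auto
  qed
  ultimately show ?thesis by (auto simp: uniform_neighborhood_def)
qed

theorem ANRU_extends:
  fixes X :: "'a uniform_structure" and Z :: "'z uniform_structure"
  assumes X: "ANRU X" and A: "A \<subseteq> uspace Z" and f: "uniformly_continuous (subuniform Z A) X f"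
  shows "extends_to_uniform_neighborhood X Z A f"
proof (cases "A = {}")
  case True
  have "uniform_cover Z {uspace Z}"
    by (auto simp: uniform_cover_def intro!: exI[of _ "\<lambda>_. True"])
  then have "uniform_neighborhood Z A {}"
    using True by (auto simp: uniform_neighborhood_def star_def)
  moreover have "uniformly_continuous (subuniform Z {}) X f"
    using f True by simp
  ultimately show ?thesis
    using True by (auto simp: extends_to_uniform_neighborhood_def)
next
  case False
  let ?P = "{d. uniform_pseudometric X d}" and ?S = "uspace X" and ?Q = "test_space X"
  have fA: "f a \<in> ?S" if "a \<in> A" for a
    using f that A by (auto simp: uniformly_continuous_def)
  have dp: "0 \<le> d x y" "d x y \<le> 1" "d x y = d y x" "d x x = 0"
    if "uniform_pseudometric X d" "x \<in> ?S" "y \<in> ?S" for d x y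
    using that by (auto simp: uniform_pseudometric_def)
  define i where "i x = (\<lambda>(d, y)\<in>?P \<times> ?S. d x y)" for x
  have i_in: "i x \<in> test_carrier X" if "x \<in> ?S" for x
    using that dp by (auto simp: i_def test_carrier_def)
  have inv: "\<exists>d\<in>?P. \<forall>x\<in>?S. \<forall>x'\<in>?S. \<bar>i x (d, x') - i x' (d, x')\<bar> < 1/2 \<longrightarrow> E (x, x')"
    if "eventually E (entourages X)" for E
  proof -
    obtain d where d: "uniform_pseudometric X d"
      "\<And>(n::nat) x y. x \<in> ?S \<Longrightarrow> y \<in> ?S \<Longrightarrow> d x y < 1 / 2 ^ Suc n \<Longrightarrow> E (x, y)"
      using uniform_pseudometric_exists[of "\<lambda>_::nat. E" X, OF \<open>eventually E (entourages X)\<close>]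
      by metis
    have "E (x, x')" if "x \<in> ?S" "x' \<in> ?S" "\<bar>i x (d, x') - i x' (d, x')\<bar> < 1/2" for x x'
    proof -
      have "d x x' < 1/2" using that dp[OF d(1)] d(1) by (simp add: i_def)
      then show ?thesis using d(2)[of x x' 0] that by simp
    qed
    with d(1) show ?thesis by blast
  qed
  have inj: "inj_on i ?S"
  proof (rule inj_onI, rule ccontr)
    fix x x' assume x: "x \<in> ?S" "x' \<in> ?S" and eq: "i x = i x'" and ne: "x \<noteq> x'"
    from X have "Hausdorff_space (utopology X)" by (simp add: ANRU_def)
    then obtain U V where U: "openin (utopology X) U" "x \<in> U" "x' \<in> V" "disjnt U V"
      using x ne unfolding Hausdorff_space_def topspace_utopology by blast
    then have "eventually (\<lambda>(u, y). u = x \<longrightarrow> y \<in> U) (entourages X)"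
      by (auto simp: openin_utopology)
    from inv[OF this] eq x have "x' \<in> U" by auto
    with U show False by (auto simp: disjnt_def)
  qed
  define j where "j = inv_into ?S i"
  have ji: "j (i x) = x" if "x \<in> ?S" for x using inj that by (simp add: j_def)
  let ?B = "i ` ?S"
  have B: "?B \<subseteq> uspace ?Q" using i_in by auto
  have "uniformly_continuous (subuniform ?Q ?B) X j"
  proof (rule uniformly_continuousI)
    show "j \<in> uspace (subuniform ?Q ?B) \<rightarrow> ?S" using ji by auto
    fix E assume "eventually E (entourages X)"
    from inv[OF this] obtain d where d: "d \<in> ?P"
      "\<And>x x'. x \<in> ?S \<Longrightarrow> x' \<in> ?S \<Longrightarrow> \<bar>i x (d, x') - i x' (d, x')\<bar> < 1/2 \<Longrightarrow> E (x, x')" by blast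
    show "eventually (\<lambda>(x, y). E (j x, j y)) (entourages (subuniform ?Q ?B))"
      unfolding entourages_subuniform eventually_inf_principal entourages_test_space
        eventually_test_entourages
    proof (intro exI[of _ "{d}"] exI[of _ "1/2"] conjI ballI impI)
      fix q r
      assume *: "\<forall>d\<in>{d}. \<forall>y\<in>?S. \<bar>q (d, y) - r (d, y)\<bar> < 1/2" "(q, r) \<in> ?B \<times> ?B"
      then obtain x x' where "x \<in> ?S" "x' \<in> ?S" "q = i x" "r = i x'" by auto
      with * show "case (q, r) of (x, y) \<Rightarrow> E (j x, j y)"
        using d(2)[of x x'] by (auto simp: ji)
    qed (use d in auto)
  qed
  with X B Hausdorff_test_space[of X] have "extends_to_uniform_neighborhood X ?Q ?B j"
    unfolding ANRU_def by blast
  then obtain N g where N: "uniform_neighborhood ?Q ?B N"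
    and g: "uniformly_continuous (subuniform ?Q N) X g" and gj: "\<And>b. b \<in> ?B \<Longrightarrow> g b = j b"
    unfolding extends_to_uniform_neighborhood_def by blast
  have "\<forall>d\<in>?P. \<exists>F. (\<forall>z\<in>uspace Z. \<forall>y\<in>?S. F z y \<in> {0..1}) \<and>
    (\<forall>a\<in>A. \<forall>y\<in>?S. F a y = d (f a) y) \<and>
    (\<forall>e>0. eventually (\<lambda>(z, z'). \<forall>y\<in>?S. \<bar>F z y - F z' y\<bar> < e) (entourages Z))"
    using uniform_pseudometric_extension[OF _ f A False] by simp
  from bchoice[OF this] obtain \<Phi> where
    \<Phi>: "\<And>d z y. d \<in> ?P \<Longrightarrow> z \<in> uspace Z \<Longrightarrow> y \<in> ?S \<Longrightarrow> \<Phi> d z y \<in> {0..1}"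
      "\<And>d a y. d \<in> ?P \<Longrightarrow> a \<in> A \<Longrightarrow> y \<in> ?S \<Longrightarrow> \<Phi> d a y = d (f a) y"
      "\<And>d e. d \<in> ?P \<Longrightarrow> 0 < e \<Longrightarrow>
        eventually (\<lambda>(z, z'). \<forall>y\<in>?S. \<bar>\<Phi> d z y - \<Phi> d z' y\<bar> < e) (entourages Z)"
    by blast
  define F where "F z = (\<lambda>(d, y)\<in>?P \<times> ?S. \<Phi> d z y)" for z
  have Fi: "F a = i (f a)" if "a \<in> A" for a
    using \<Phi>(2)[OF _ that] by (auto simp: F_def i_def fun_eq_iff restrict_def)
  have F: "uniformly_continuous Z ?Q F"
  proof (rule uniformly_continuousI)
    show "F \<in> uspace Z \<rightarrow> uspace ?Q"
      using \<Phi>(1) unfolding uspace_test_space test_carrier_def F_def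
      by (intro Pi_I restrict_PiE_iff[THEN iffD2]) auto
    then have FQ: "F z \<in> test_carrier X" if "z \<in> uspace Z" for z using that by auto
    fix E assume "eventually E (entourages ?Q)"
    then obtain D e where D: "finite D" "D \<subseteq> ?P" "0 < e"
      and E: "\<And>q r. \<lbrakk>q \<in> test_carrier X; r \<in> test_carrier X;
        \<forall>d\<in>D. \<forall>y\<in>?S. \<bar>q (d, y) - r (d, y)\<bar> < e\<rbrakk> \<Longrightarrow> E (q, r)"
      unfolding entourages_test_space eventually_test_entourages by blast
    have "eventually (\<lambda>p. \<forall>d\<in>D. \<forall>y\<in>?S. \<bar>\<Phi> d (fst p) y - \<Phi> d (snd p) y\<bar> < e) (entourages Z)"
      by (rule eventually_ball_finite[OF D(1)]) (use \<Phi>(3) D in \<open>auto simp: split_beta'\<close>)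
    with eventually_entourages_carrier[of Z]
    show "eventually (\<lambda>(x, y). E (F x, F y)) (entourages Z)"
    proof eventually_elim
      case (elim p)
      obtain x y where p: "p = (x, y)" by (cases p)
      have "E (F x, F y)"
      proof (rule E)
        show "\<forall>d\<in>D. \<forall>u\<in>?S. \<bar>F x (d, u) - F y (d, u)\<bar> < e"
          using elim D(2) by (auto simp: p F_def)
      qed (use elim FQ p in auto)
      then show ?case by (simp add: p)
    qed
  qed
  define M where "M = {z \<in> uspace Z. F z \<in> N}"
  have "uniform_neighborhood Z A M"
    unfolding M_def by (rule uniform_neighborhood_vimage[OF F N _ A]) (use Fi fA in auto)
  moreover have "uniformly_continuous (subuniform Z M) X (g \<circ> F)"
  proof (rule uniformly_continuousI)
    show "g \<circ> F \<in> uspace (subuniform Z M) \<rightarrow> ?S"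
      using g F by (fastforce simp: uniformly_continuous_def M_def)
    fix E assume "eventually E (entourages X)"
    from uniformly_continuousD[OF g this]
    have "eventually (\<lambda>p. p \<in> N \<times> N \<longrightarrow> (case p of (x, y) \<Rightarrow> E (g x, g y))) (entourages ?Q)"
      by (simp add: eventually_inf_principal)
    from uniformly_continuousD[OF F this]
    show "eventually (\<lambda>(x, y). E ((g \<circ> F) x, (g \<circ> F) y)) (entourages (subuniform Z M))"
      unfolding entourages_subuniform eventually_inf_principal
      by (auto simp: M_def elim: eventually_mono)
  qed
  moreover have "(g \<circ> F) a = f a" if "a \<in> A" for a
    using Fi[OF that] gj fA[OF that] ji by simp
  ultimately show ?thesis
    unfolding extends_to_uniform_neighborhood_def by blast
qed


section \<open>Uniform homotopy domination\<close>

definition uniform_interval :: "real uniform_structure" where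
  "uniform_interval = uniform_of_metric (submetric euclidean_metric {0..1})"

definition uniformly_homotopy_dominated ::
    "'a set set \<Rightarrow> 'a uniform_structure \<Rightarrow> 'b uniform_structure \<Rightarrow> bool" where
  "uniformly_homotopy_dominated C X Y \<longleftrightarrow>
     (\<exists>u v H. uniformly_continuous X Y u \<and> uniformly_continuous Y X v \<and>
        uniformly_continuous (prod_uniform X uniform_interval) X H \<and>
        (\<forall>x\<in>uspace X. H (x, 0) = v (u x) \<and> H (x, 1) = x) \<and>
        (\<forall>x\<in>uspace X. \<exists>U\<in>C. H ` ({x} \<times> {0..1}) \<subseteq> U))"


section \<open>Geometric realization\<close>

text \<open>
  A poset is a set of elements of an order type. Functions on \<open>P\<close> are extensional, i.e. they
  take the value \<open>undefined\<close> outside \<open>P\<close>. The case distinctions in the distance only make it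
  total: the type \<open>'a metric\<close> asks for symmetry and nonnegativity outside the carrier, and
  the supremum of the empty set of reals is unspecified.
\<close>

definition cube :: "'p set \<Rightarrow> ('p \<Rightarrow> real) set" where
  "cube P = (P \<rightarrow>\<^sub>E {0..1})"

definition cube_dist :: "'p set \<Rightarrow> ('p \<Rightarrow> real) \<Rightarrow> ('p \<Rightarrow> real) \<Rightarrow> real" where
  "cube_dist P f g =
     (if f \<in> cube P \<and> g \<in> cube P \<and> P \<noteq> {} then SUP s\<in>P. \<bar>f s - g s\<bar> else 0)"

definition cube_metric :: "'p set \<Rightarrow> ('p \<Rightarrow> real) metric" where
  "cube_metric P = metric (cube P, cube_dist P)"

lemma cube_diff_bound: "f \<in> cube P \<Longrightarrow> g \<in> cube P \<Longrightarrow> s \<in> P \<Longrightarrow> \<bar>f s - g s\<bar> \<le> 1"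
  by (fastforce simp: cube_def PiE_def Pi_def abs_le_iff)

lemma cube_dist_upper: "f \<in> cube P \<Longrightarrow> g \<in> cube P \<Longrightarrow> s \<in> P \<Longrightarrow> \<bar>f s - g s\<bar> \<le> cube_dist P f g"
proof -
  assume *: "f \<in> cube P" "g \<in> cube P" "s \<in> P"
  have "\<bar>f s - g s\<bar> \<le> (SUP s\<in>P. \<bar>f s - g s\<bar>)"
    by (intro cSUP_upper * bdd_aboveI2[of P _ 1] cube_diff_bound[OF *(1,2)])
  with * show ?thesis by (auto simp: cube_dist_def)
qed

lemma Metric_space_cube: "Metric_space (cube P) (cube_dist P)"
proof
  fix f g h :: "'a \<Rightarrow> real"
  show "0 \<le> cube_dist P f g"
  proof (cases "f \<in> cube P \<and> g \<in> cube P \<and> P \<noteq> {}")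
    case True
    then obtain s where "s \<in> P" by blast
    with True cube_dist_upper[of f P g s] show ?thesis by linarith
  qed (auto simp: cube_dist_def)
  show "cube_dist P f g = cube_dist P g f"
    by (auto simp: cube_dist_def abs_minus_commute)
  assume f: "f \<in> cube P" and g: "g \<in> cube P"
  show "cube_dist P f g = 0 \<longleftrightarrow> f = g"
  proof
    assume "cube_dist P f g = 0"
    then have "f s = g s" if "s \<in> P" for s
      using cube_dist_upper[OF f g that] by simp
    with f g show "f = g" unfolding cube_def by (metis PiE_ext)
  qed (auto simp: cube_dist_def)
  assume h: "h \<in> cube P"
  show "cube_dist P f h \<le> cube_dist P f g + cube_dist P g h"
  proof (cases "P = {}")
    case False
    have "(SUP s\<in>P. \<bar>f s - h s\<bar>) \<le> cube_dist P f g + cube_dist P g h"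
    proof (rule cSUP_least[OF False])
      fix s assume "s \<in> P"
      with cube_dist_upper[OF f g] cube_dist_upper[OF g h]
      show "\<bar>f s - h s\<bar> \<le> cube_dist P f g + cube_dist P g h" by fastforce
    qed
    then show ?thesis using f h False by (simp add: cube_dist_def)
  qed (auto simp: cube_dist_def)
qed

lemma mspace_cube_metric [simp]: "mspace (cube_metric P) = cube P"
  and mdist_cube_metric [simp]: "mdist (cube_metric P) = cube_dist P"
  by (simp_all add: cube_metric_def Metric_space.mspace_metric Metric_space.mdist_metric
      Metric_space_cube)

definition poset_vertex :: "'p::order set \<Rightarrow> 'p \<Rightarrow> 'p \<Rightarrow> real" where
  "poset_vertex P p = (\<lambda>q\<in>P. if q \<le> p then 1 else 0)"

text \<open>
  The convex hull of the vertices in a finite set \<open>c\<close>, spelled out because function spaces are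
  not an instance of \<open>real_vector\<close>.
\<close>

definition poset_hull :: "'p::order set \<Rightarrow> 'p set \<Rightarrow> ('p \<Rightarrow> real) set" where
  "poset_hull P c = {(\<lambda>q\<in>P. \<Sum>p\<in>c. w p * poset_vertex P p q) | w.
     (\<forall>p\<in>c. 0 \<le> w p) \<and> (\<Sum>p\<in>c. w p) = 1}"

definition realization_points :: "'p::order set \<Rightarrow> ('p \<Rightarrow> real) set" where
  "realization_points P =
     \<Union>{poset_hull P c | c. c \<subseteq> P \<and> c \<noteq> {} \<and> finite c \<and> Complete_Partial_Order.chain (\<le>) c}"

lemma realization_points_subset: "realization_points P \<subseteq> cube P"
proof
  fix x assume "x \<in> realization_points P"
  then obtain c w where c: "finite c" and w: "\<And>p. p \<in> c \<Longrightarrow> 0 \<le> w p" "(\<Sum>p\<in>c. w p) = (1::real)"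
    and x: "x = (\<lambda>q\<in>P. \<Sum>p\<in>c. w p * poset_vertex P p q)"
    unfolding realization_points_def poset_hull_def by blast
  have "0 \<le> (\<Sum>p\<in>c. w p * poset_vertex P p q) \<and> (\<Sum>p\<in>c. w p * poset_vertex P p q) \<le> 1"
    if "q \<in> P" for q
  proof
    show "0 \<le> (\<Sum>p\<in>c. w p * poset_vertex P p q)"
      by (intro sum_nonneg mult_nonneg_nonneg) (auto simp: w poset_vertex_def that)
    have "(\<Sum>p\<in>c. w p * poset_vertex P p q) \<le> (\<Sum>p\<in>c. w p)"
      by (intro sum_mono) (auto simp: w poset_vertex_def that)
    with w show "(\<Sum>p\<in>c. w p * poset_vertex P p q) \<le> 1" by simp
  qed
  then show "x \<in> cube P" by (auto simp: x cube_def)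
qed

definition poset_realization :: "'p::order set \<Rightarrow> ('p \<Rightarrow> real) uniform_structure" where
  "poset_realization P = uniform_of_metric (submetric (cube_metric P) (realization_points P))"

text \<open>A simplicial complex is given by its set of nonempty simplices, which is also the poset
  to be realized: the order of \<open>'v set\<close> is inclusion.\<close>

definition abstract_simplicial_complex :: "'v set set \<Rightarrow> bool" where
  "abstract_simplicial_complex K \<longleftrightarrow>
     (\<forall>\<sigma>\<in>K. finite \<sigma> \<and> \<sigma> \<noteq> {} \<and> (\<forall>\<tau>. \<tau> \<subseteq> \<sigma> \<and> \<tau> \<noteq> {} \<longrightarrow> \<tau> \<in> K))"

end

theory Submission
  imports Defs
begin

text \<open>
  Embed \<open>X\<close> in the test space \<open>Q\<close> by \<open>x \<mapsto> ((d, y) \<mapsto> d x y)\<close>; the ANRU property yields a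
  uniformly continuous retraction \<open>r\<close> of a uniform neighborhood of \<open>X\<close> in \<open>Q\<close>, which depends on
  finitely many pseudometrics only. For a bounded uniform pseudometric dominating these,
  separability gives a countable point-finite equi-Lipschitz family \<open>f\<^sub>n\<close> with \<open>sup f\<^sub>n = 1\<close>,
  where \<open>f\<^sub>n\<close> is supported near the point \<open>x\<^sub>n\<close> of a dense sequence. Let \<open>K\<close> consist of the finite
  sets of indices of points that are close to each other. Points of \<open>|K|\<close> amount to
  functions on the vertices with support in \<open>K\<close> and maximum 1, under the sup metric, so
  the \<open>f\<^sub>n\<close> define \<open>u : X \<rightarrow> |K|\<close>. Convex combinations of the \<open>x\<^sub>n\<close> are not uniformly continuous in the
  sup metric, but the tropical ones \<open>(d, y) \<mapsto> inf\<^sub>n (d x\<^sub>n y + 1 - g n)\<close> are;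
  they map \<open>|K|\<close> into the neighborhood of \<open>X\<close>. Composing with \<open>r\<close> gives \<open>v\<close>, and the
  homotopy is \<open>r\<close> applied to the linear one in \<open>Q\<close>.
\<close>

section \<open>Points of the realization of a simplicial complex\<close>

lemma abs_Min_diff_le:
  fixes f g :: "'v \<Rightarrow> real"
  assumes "finite S" "S \<noteq> {}" "\<And>v. v \<in> S \<Longrightarrow> \<bar>f v - g v\<bar> \<le> c"
  shows "\<bar>Min (f ` S) - Min (g ` S)\<bar> \<le> c"
proof -
  have *: "Min (h ` S) \<le> Min (k ` S) + c" if "\<And>v. v \<in> S \<Longrightarrow> h v \<le> k v + c" for h k :: "'v \<Rightarrow> real"
  proof -
    have "Min (k ` S) \<in> k ` S" using assms by (intro Min_in) auto
    then obtain v where "v \<in> S" "Min (k ` S) = k v" by auto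
    moreover from this have "Min (h ` S) \<le> h v" using assms by (intro Min_le) auto
    ultimately show ?thesis using that[of v] by simp
  qed
  have "f v \<le> g v + c" "g v \<le> f v + c" if "v \<in> S" for v
    using assms(3)[OF that] by linarith+
  from *[of f g, OF this(1)] *[of g f, OF this(2)] show ?thesis by (simp add: abs_le_iff)
qed

text \<open>Induction on the support, splitting off the minimal value.\<close>

lemma level_set_decomposition:
  fixes f :: "'v \<Rightarrow> real"
  assumes "finite S" "\<And>v. v \<in> S \<Longrightarrow> 0 < f v"
  shows "\<exists>c w. c \<subseteq> Pow S - {{}} \<and> finite c \<and> Complete_Partial_Order.chain (\<le>) c \<and>
    (\<forall>p\<in>c. 0 \<le> w p) \<and>
    (\<forall>\<sigma>. \<sigma> \<noteq> {} \<longrightarrow> (\<Sum>p\<in>c. if \<sigma> \<subseteq> p then w p else 0) = (if \<sigma> \<subseteq> S then Min (f ` \<sigma>) else 0)) \<and>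
    (\<forall>v\<in>S. (\<forall>u\<in>S. f u \<le> f v) \<longrightarrow> (\<Sum>p\<in>c. w p) = f v)"
  using assms
proof (induction "card S" arbitrary: S f rule: less_induct)
  case less
  show ?case
  proof (cases "S = {}")
    case True
    then show ?thesis by (intro exI[of _ "{}"]) (auto simp: Complete_Partial_Order.chain_def)
  next
    case False
    \<comment> \<open>The minimum \<open>a\<close> becomes the weight of \<open>S\<close> itself;
      the rest of the chain comes from \<open>f - a\<close>, which is positive exactly on the strict
      superlevel set \<open>S'\<close>.\<close>
    define a where "a = Min (f ` S)"
    define S' where "S' = {v \<in> S. a < f v}"
    have "a \<in> f ` S" unfolding a_def using less.prems False by (intro Min_in) auto
    then obtain v0 where v0: "v0 \<in> S" "f v0 = a" by auto
    have a_le: "a \<le> f v" if "v \<in> S" for v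
      unfolding a_def using less.prems that by (intro Min_le) auto
    have a0: "0 < a" using v0 less.prems(2) by auto
    have S'S: "S' \<subseteq> S" "v0 \<notin> S'" using v0 by (auto simp: S'_def)
    have fS': "finite S'" using S'S less.prems(1) finite_subset by blast
    have "card S' < card S" using S'S v0 less.prems(1) by (intro psubset_card_mono) auto
    from less.hyps[OF this fS', of "\<lambda>v. f v - a"] obtain c w where
      c: "c \<subseteq> Pow S' - {{}}" "finite c" "Complete_Partial_Order.chain (\<le>) c" "\<forall>p\<in>c. 0 \<le> w p"
      and sums: "\<And>\<sigma>. \<sigma> \<noteq> {} \<Longrightarrow> (\<Sum>p\<in>c. if \<sigma> \<subseteq> p then w p else 0)
          = (if \<sigma> \<subseteq> S' then Min ((\<lambda>v. f v - a) ` \<sigma>) else 0)"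
      and total: "\<And>v. v \<in> S' \<Longrightarrow> (\<forall>u\<in>S'. f u \<le> f v) \<Longrightarrow> (\<Sum>p\<in>c. w p) = f v - a"
      by (force simp: S'_def)
    \<comment> \<open>Members of \<open>c\<close> avoid \<open>v0\<close>, so giving
      \<open>S\<close> the weight \<open>a\<close> leaves the earlier weights intact.\<close>
    have Sc: "S \<notin> c" using c(1) S'S v0 by auto
    define w' where "w' = w(S := a)"
    have w': "w' p = w p" if "p \<in> c" for p using that Sc by (auto simp: w'_def)
    have sum': "(\<Sum>p\<in>insert S c. if Q p then w' p else 0) =
        (if Q S then a else 0) + (\<Sum>p\<in>c. if Q p then w p else 0)" for Q
    proof -
      have "(\<Sum>p\<in>c. if Q p then w' p else 0) = (\<Sum>p\<in>c. if Q p then w p else 0)"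
        using w' by (intro sum.cong) auto
      then show ?thesis using c(2) Sc by (simp add: w'_def)
    qed
    show ?thesis
    proof (intro exI[of _ "insert S c"] exI[of _ w'] conjI allI ballI impI)
      show "insert S c \<subseteq> Pow S - {{}}" using c(1) S'S False by auto
      show "finite (insert S c)" using c(2) by simp
      show "Complete_Partial_Order.chain (\<le>) (insert S c)"
        using c(1,3) S'S unfolding Complete_Partial_Order.chain_def by blast
      show "0 \<le> w' p" if "p \<in> insert S c" for p
        using that c(4) a0 by (auto simp: w'_def)
    next
      fix \<sigma> :: "'v set" assume ne: "\<sigma> \<noteq> {}"
      show "(\<Sum>p\<in>insert S c. if \<sigma> \<subseteq> p then w' p else 0) = (if \<sigma> \<subseteq> S then Min (f ` \<sigma>) else 0)"
      proof (cases "\<sigma> \<subseteq> S")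
        case True
        have fin: "finite \<sigma>" using True less.prems(1) finite_subset by blast
        show ?thesis
        proof (cases "\<sigma> \<subseteq> S'")
          case T': True
          have "Min ((\<lambda>v. f v + (- a)) ` \<sigma>) = Min (f ` \<sigma>) + (- a)"
            by (rule Min_add_commute[OF fin ne])
          then show ?thesis using True T' by (simp add: sum' sums ne)
        next
          case F': False
          then obtain v where v: "v \<in> \<sigma>" "f v = a" using True a_le by (force simp: S'_def)
          have "Min (f ` \<sigma>) = a"
            using v fin a_le True by (intro Min_eqI) auto
          then show ?thesis using True F' by (simp add: sum' sums ne)
        qed
      next
        case False
        then have "\<not> \<sigma> \<subseteq> S'" using S'S by auto
        with False show ?thesis by (simp add: sum' sums ne)
      qed
    next
      fix v assume v: "v \<in> S" "\<forall>u\<in>S. f u \<le> f v"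
      have eq: "(\<Sum>p\<in>insert S c. w' p) = a + (\<Sum>p\<in>c. w p)" using sum'[of "\<lambda>_. True"] by simp
      show "(\<Sum>p\<in>insert S c. w' p) = f v"
      proof (cases "v \<in> S'")
        case True
        then have "(\<Sum>p\<in>c. w p) = f v - a" using v S'S by (intro total) auto
        then show ?thesis by (simp add: eq)
      next
        case False
        \<comment> \<open>Here maximum and minimum agree: \<open>S'\<close> and hence
          \<open>c\<close> are empty, and \<open>S\<close> carries all the weight.\<close>
        then have "f v = a" using a_le[OF v(1)] v(1) by (auto simp: S'_def)
        then have "S' = {}" using v(2) by (auto simp: S'_def)
        then have "c = {}" using c(1) by auto
        then show ?thesis using \<open>f v = a\<close> eq by simp
      qed
    qed
  qed
qed

lemma abstract_simplicial_complex_subset: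
  "\<lbrakk>abstract_simplicial_complex K; \<sigma> \<in> K; \<tau> \<subseteq> \<sigma>; \<tau> \<noteq> {}\<rbrakk> \<Longrightarrow> \<tau> \<in> K"
  unfolding abstract_simplicial_complex_def by blast

text \<open>The chain consists of superlevel sets of \<open>f\<close>, which are faces of the
  support. The vertex function of \<open>p\<close> is the indicator of the faces of
  \<open>p\<close>, so the convex combination at \<open>\<sigma>\<close> is the total weight of the
  chain members containing \<open>\<sigma>\<close>, which is the minimum of \<open>f\<close> over
  \<open>\<sigma>\<close>. All weights together sum to the maximum of \<open>f\<close>, which is
  1.\<close>

lemma Min_in_realization_points:
  fixes f :: "'v \<Rightarrow> real"
  assumes K: "abstract_simplicial_complex K" and S: "{v. 0 < f v} \<in> K"
    and f: "\<And>v. 0 \<le> f v" "\<And>v. f v \<le> 1" "f v1 = 1"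
  shows "(\<lambda>\<sigma>\<in>K. Min (f ` \<sigma>)) \<in> realization_points K"
proof -
  let ?S = "{v. 0 < f v}"
  have fin: "finite ?S" using K S by (auto simp: abstract_simplicial_complex_def)
  obtain c w where c: "c \<subseteq> Pow ?S - {{}}" "finite c" "Complete_Partial_Order.chain (\<le>) c"
      "\<forall>p\<in>c. 0 \<le> w p"
    and sums: "\<And>\<sigma>. \<sigma> \<noteq> {} \<Longrightarrow> (\<Sum>p\<in>c. if \<sigma> \<subseteq> p then w p else 0)
          = (if \<sigma> \<subseteq> ?S then Min (f ` \<sigma>) else 0)"
    and total: "\<And>v. v \<in> ?S \<Longrightarrow> (\<forall>u\<in>?S. f u \<le> f v) \<Longrightarrow> (\<Sum>p\<in>c. w p) = f v"
    using level_set_decomposition[OF fin, of f] by auto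
  have w1: "(\<Sum>p\<in>c. w p) = 1" using total[of v1] f by simp
  have cK: "c \<subseteq> K" using c(1) abstract_simplicial_complex_subset[OF K S] by blast
  have "c \<noteq> {}" using w1 by auto
  moreover have "(\<lambda>\<sigma>\<in>K. Min (f ` \<sigma>)) = (\<lambda>q\<in>K. \<Sum>p\<in>c. w p * poset_vertex K p q)"
  proof (rule restrict_ext)
    fix \<sigma> assume \<sigma>: "\<sigma> \<in> K"
    then have ne: "\<sigma> \<noteq> {}" "finite \<sigma>" using K by (auto simp: abstract_simplicial_complex_def)
    have "(\<Sum>p\<in>c. w p * poset_vertex K p \<sigma>) = (\<Sum>p\<in>c. if \<sigma> \<subseteq> p then w p else 0)"
      using \<sigma> by (intro sum.cong) (auto simp: poset_vertex_def)
    also have "\<dots> = Min (f ` \<sigma>)"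
    proof (cases "\<sigma> \<subseteq> ?S")
      case False
      then obtain v where v: "v \<in> \<sigma>" "f v = 0" using f(1) by (auto simp: less_le)
      then have "Min (f ` \<sigma>) = 0" using ne f(1) by (intro Min_eqI) (auto intro: image_eqI[of _ _ v])
      then show ?thesis using sums[OF ne(1)] False by simp
    qed (use sums[OF ne(1)] in simp)
    finally show "Min (f ` \<sigma>) = (\<Sum>p\<in>c. w p * poset_vertex K p \<sigma>)" by simp
  qed
  ultimately show ?thesis
    unfolding realization_points_def poset_hull_def using c(2-4) w1 cK by blast
qed

text \<open>The value \<open>g {v}\<close> is the total weight of the chain members that contain
  \<open>v\<close>. Vertices of the least member therefore get the value 1. Two vertices of positive
  value lie in comparable members, and the larger one contains both.\<close>

lemma realization_points_simplex:
  assumes K: "abstract_simplicial_complex K" and g: "g \<in> realization_points K"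
  shows "\<exists>v. {v} \<in> K \<and> g {v} = 1"
    and "\<lbrakk>{u} \<in> K; {v} \<in> K; 0 < g {u}; 0 < g {v}\<rbrakk> \<Longrightarrow> {u, v} \<in> K"
proof -
  obtain c w where c: "c \<subseteq> K" "c \<noteq> {}" "finite c" "Complete_Partial_Order.chain (\<le>) c"
    and w: "\<And>p. p \<in> c \<Longrightarrow> 0 \<le> w p" "(\<Sum>p\<in>c. w p) = (1::real)"
    and geq: "g = (\<lambda>q\<in>K. \<Sum>p\<in>c. w p * poset_vertex K p q)"
    using g unfolding realization_points_def poset_hull_def by blast
  have gv: "g {v} = (\<Sum>p\<in>c. if v \<in> p then w p else 0)" if "{v} \<in> K" for v
    using that unfolding geq by (auto simp: poset_vertex_def intro!: sum.cong)
  obtain p0 where p0: "p0 \<in> c" "\<And>p. p \<in> c \<Longrightarrow> p \<subseteq> p0 \<Longrightarrow> p0 = p"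
    using finite_has_minimal[OF c(3,2)] by auto
  have "p0 \<noteq> {}" using p0(1) c(1) K by (auto simp: abstract_simplicial_complex_def)
  then obtain v where v: "v \<in> p0" by blast
  have "(\<Sum>p\<in>c. if v \<in> p then w p else 0) = (\<Sum>p\<in>c. w p)"
  proof (rule sum.cong)
    \<comment> \<open>In a chain the minimal member \<open>p0\<close> is the least one, so
      \<open>v\<close> lies in every member.\<close>
    fix p assume that: "p \<in> c"
    have "v \<in> p"
      using c(4) p0 that v unfolding Complete_Partial_Order.chain_def by blast
    then show "(if v \<in> p then w p else 0) = w p" by simp
  qed simp
  moreover have vK: "{v} \<in> K"
    using v p0(1) c(1) by (intro abstract_simplicial_complex_subset[OF K subsetD[of c K p0]]) auto
  ultimately have "g {v} = 1" using gv w(2) by simp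
  with vK show "\<exists>v. {v} \<in> K \<and> g {v} = 1" by blast
  have ex: "\<exists>p\<in>c. v \<in> p" if "{v} \<in> K" "0 < g {v}" for v
  proof (rule ccontr)
    assume "\<not> ?thesis"
    then have "(\<Sum>p\<in>c. if v \<in> p then w p else 0) = 0" by (intro sum.neutral) auto
    then show False using that gv by simp
  qed
  show "{u, v} \<in> K" if uv: "{u} \<in> K" "{v} \<in> K" "0 < g {u}" "0 < g {v}" for u v
  proof -
    obtain p q where "p \<in> c" "u \<in> p" "q \<in> c" "v \<in> q" using ex[of u] ex[of v] uv by blast
    then obtain p where "p \<in> c" "{u, v} \<subseteq> p"
      using c(4) unfolding Complete_Partial_Order.chain_def by blast
    then show ?thesis using c(1) by (intro abstract_simplicial_complex_subset[OF K subsetD[of c K p]]) auto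
  qed
qed

section \<open>Point-finite families and tropical combinations\<close>

lemma uniform_pseudometricD:
  assumes "uniform_pseudometric X d"
  shows "x \<in> uspace X \<Longrightarrow> y \<in> uspace X \<Longrightarrow> 0 \<le> d x y"
    and "x \<in> uspace X \<Longrightarrow> y \<in> uspace X \<Longrightarrow> d x y \<le> 1"
    and "x \<in> uspace X \<Longrightarrow> y \<in> uspace X \<Longrightarrow> d x y = d y x"
    and "x \<in> uspace X \<Longrightarrow> d x x = 0"
    and "\<lbrakk>x \<in> uspace X; y \<in> uspace X; z \<in> uspace X\<rbrakk> \<Longrightarrow> d x z \<le> d x y + d y z"
    and "0 < e \<Longrightarrow> eventually (\<lambda>(x, y). d x y < e) (entourages X)"
  using assms unfolding uniform_pseudometric_def by blast+

lemma uniform_pseudometric_diff_le: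
  assumes "uniform_pseudometric X d" "x \<in> uspace X" "y \<in> uspace X" "z \<in> uspace X"
  shows "\<bar>d x z - d y z\<bar> \<le> d x y"
  using uniform_pseudometricD(3,5)[OF assms(1)] assms(2-4) by (smt (verit))

text \<open>Balls of a uniform pseudometric are open, so one sequence meets all of them, whichever
  pseudometric is chosen later.\<close>

lemma separable_dense_sequence:
  assumes sep: "separable_space (utopology X)" and ne: "uspace X \<noteq> {}"
  obtains x :: "nat \<Rightarrow> 'a" where "\<And>n. x n \<in> uspace X"
    "\<And>d z e. \<lbrakk>uniform_pseudometric X d; z \<in> uspace X; 0 < e\<rbrakk> \<Longrightarrow> \<exists>n. d z (x n) < e"
proof -
  obtain A where A: "countable A" "A \<subseteq> uspace X" "(utopology X) closure_of A = uspace X"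
    using sep unfolding separable_space_def by auto
  have "A \<noteq> {}" using A ne by auto
  \<comment> \<open>If \<open>A\<close> is finite, the enumeration repeats points; the indices still
    range over all of \<open>nat\<close>.\<close>
  then have x: "from_nat_into A n \<in> uspace X" for n using from_nat_into[of A n] A(2) by auto
  moreover have "\<exists>n. d z (from_nat_into A n) < e"
    if d: "uniform_pseudometric X d" and z: "z \<in> uspace X" and e: "0 < e" for d z e
  proof -
    note D = uniform_pseudometricD[OF d]
    let ?B = "{y \<in> uspace X. d z y < e}"
    have "openin (utopology X) ?B"
      unfolding openin_utopology
    proof (intro conjI ballI)
      fix y assume y: "y \<in> ?B"
      have "eventually (\<lambda>(a, b). d a b < e - d z y) (entourages X)" using D(6) y by simp
      with eventually_entourages_carrier[of X]
      show "eventually (\<lambda>(a, b). a = y \<longrightarrow> b \<in> ?B) (entourages X)"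
      proof eventually_elim
        case (elim p)
        then show ?case using D(5)[of z y "snd p"] z y by (auto simp: split_beta')
      qed
    qed auto
    moreover have "z \<in> ?B" using z e D(4) by simp
    moreover have "z \<in> (utopology X) closure_of A" using A z by simp
    ultimately have "\<exists>a. a \<in> A \<and> a \<in> ?B" unfolding in_closure_of by meson
    then obtain a where "a \<in> A" "d z a < e" by blast
    then show ?thesis using from_nat_into_surj[OF A(1)] by metis
  qed
  ultimately show ?thesis by (rule that)
qed

text \<open>Finite minima and truncation preserve the constant \<open>1 / e\<close>, which is why
  the maximum is made 1 and no division by a sum occurs. A point within \<open>e\<close> of
  \<open>x m\<close> annihilates all functions after the \<open>m\<close>-th, so the family is
  point-finite.\<close>

lemma point_finite_lipschitz_family:
  fixes x :: "nat \<Rightarrow> 'a"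
  assumes d: "uniform_pseudometric X d" and x: "\<And>n. x n \<in> uspace X" and e: "0 < e"
    and dense: "\<And>z. z \<in> uspace X \<Longrightarrow> \<exists>n. d z (x n) < e"
  obtains f :: "nat \<Rightarrow> 'a \<Rightarrow> real" where "\<And>n z. 0 \<le> f n z" "\<And>n z. f n z \<le> 1"
    "\<And>n y z. y \<in> uspace X \<Longrightarrow> z \<in> uspace X \<Longrightarrow> \<bar>f n y - f n z\<bar> \<le> d y z / e"
    "\<And>n z. 0 < f n z \<Longrightarrow> d z (x n) < 3 * e"
    "\<And>z. z \<in> uspace X \<Longrightarrow> finite {n. 0 < f n z}"
    "\<And>z. z \<in> uspace X \<Longrightarrow> \<exists>n. f n z = 1"
proof -
  note D = uniform_pseudometricD[OF d]
  \<comment> \<open>\<open>f n\<close> is positive only within \<open>3e\<close> of \<open>x n\<close> and outside the \<open>e\<close>-balls about the earlier points,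
    and equals 1 within \<open>2e\<close> of \<open>x n\<close> and outside the \<open>2e\<close>-balls about the earlier points\<close>
  define h where "h n z m = (if m = n then 3 - d z (x n) / e else d z (x m) / e - 1)" for n m z
  define f where "f n z = max 0 (min 1 (Min (h n z ` {..n})))" for n z
  have hlip: "\<bar>h n y m - h n z m\<bar> \<le> d y z / e" if "y \<in> uspace X" "z \<in> uspace X" for n m y z
  proof -
    have "\<bar>d y (x k) / e - d z (x k) / e\<bar> \<le> d y z / e" for k
      using divide_right_mono[OF uniform_pseudometric_diff_le[OF d that x[of k]], of e] e
      by (simp flip: diff_divide_distrib)
    from this[of n] this[of m] show ?thesis by (auto simp: h_def)
  qed
  show ?thesis
  proof (rule that)
    show "0 \<le> f n z" "f n z \<le> 1" for n z by (auto simp: f_def)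
    show "\<bar>f n y - f n z\<bar> \<le> d y z / e" if "y \<in> uspace X" "z \<in> uspace X" for n y z
    proof -
      have "\<bar>Min (h n y ` {..n}) - Min (h n z ` {..n})\<bar> \<le> d y z / e"
        by (rule abs_Min_diff_le) (use hlip that in auto)
      then show ?thesis unfolding f_def by linarith
    qed
    have pos: "0 < h n z m" if "0 < f n z" "m \<le> n" for n z m
    proof -
      have "0 < Min (h n z ` {..n})" using that(1) unfolding f_def by linarith
      also have "\<dots> \<le> h n z m" using that(2) by (intro Min_le) auto
      finally show ?thesis .
    qed
    show "d z (x n) < 3 * e" if "0 < f n z" for n z
      using pos[OF that, of n] e by (simp add: h_def field_simps)
    fix z assume z: "z \<in> uspace X"
    obtain m where m: "d z (x m) < e" using dense[OF z] by blast
    have "n \<le> m" if "0 < f n z" for n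
    proof (rule ccontr)
      assume "\<not> n \<le> m"
      with pos[OF that, of m] m e show False by (simp add: h_def field_simps)
    qed
    then show "finite {n. 0 < f n z}" by (auto intro: finite_subset[of _ "{..m}"])
    \<comment> \<open>The slopes \<open>3 - t / e\<close> and \<open>t / e - 1\<close> both take the
      value 1 at \<open>t = 2 * e\<close>, so the first index within this distance has value
      1.\<close>
    define k where "k = (LEAST n. d z (x n) < 2 * e)"
    have ex: "d z (x m) < 2 * e" using m e by simp
    have k: "d z (x k) < 2 * e" unfolding k_def using ex by (rule LeastI)
    have "1 \<le> h k z i" if "i \<le> k" for i
    proof (cases "i = k")
      case True then show ?thesis using k e by (simp add: h_def field_simps)
    next
      case False
      then have "\<not> d z (x i) < 2 * e" using that not_less_Least[of i "\<lambda>n. d z (x n) < 2 * e"]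
        by (simp add: k_def)
      then show ?thesis using False e by (simp add: h_def field_simps)
    qed
    then have "1 \<le> Min (h k z ` {..k})" by (subst Min_ge_iff) auto
    then have "f k z = 1" by (simp add: f_def)
    then show "\<exists>n. f n z = 1" by blast
  qed
qed

text \<open>The min-plus analogue of a convex combination of distance functions, with the penalty
  \<open>1 - g n\<close> as coefficient. A term with \<open>g n = 1\<close> counts in full. One with
  \<open>g n = 0\<close> is at least 1 and so has no effect once some \<open>g m = 1\<close>, as
  \<open>d\<close> is bounded by 1.\<close>

definition tropical_combination ::
    "('a \<Rightarrow> 'a \<Rightarrow> real) \<Rightarrow> (nat \<Rightarrow> 'a) \<Rightarrow> (nat \<Rightarrow> real) \<Rightarrow> 'a \<Rightarrow> real" where
  "tropical_combination d x g y = (INF n. d (x n) y + (1 - g n))"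

context
  fixes X :: "'a uniform_structure" and d x
  assumes d: "uniform_pseudometric X d" and x: "\<And>n::nat. x n \<in> uspace X"
begin

lemma bdd_below_tropical_combination:
  assumes "\<And>n. g n \<le> 1" "y \<in> uspace X"
  shows "bdd_below (range (\<lambda>n. d (x n) y + (1 - g n)))"
  by (rule bdd_belowI2[of _ 0]) (use uniform_pseudometricD(1)[OF d x] assms in fastforce)

lemma tropical_combination_in:
  assumes "\<And>n. g n \<le> 1" "g m = 1" "y \<in> uspace X"
  shows "tropical_combination d x g y \<in> {0..1}"
proof -
  have "tropical_combination d x g y \<le> d (x m) y + (1 - g m)"
    unfolding tropical_combination_def
    by (rule cINF_lower[OF bdd_below_tropical_combination]) (use assms in auto)
  moreover have "0 \<le> tropical_combination d x g y"
    unfolding tropical_combination_def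
    by (rule cINF_greatest) (use uniform_pseudometricD(1)[OF d x assms(3)] assms(1) in \<open>auto simp: add_nonneg_nonneg\<close>)
  ultimately show ?thesis using assms(2) uniform_pseudometricD(2)[OF d x assms(3), of m] by simp
qed

text \<open>Each term of the infimum moves by at most \<open>c\<close>, hence so does the infimum.
  The number of terms does not enter, as it would for sums.\<close>

lemma tropical_combination_diff_le:
  assumes "\<And>n. g n \<le> 1" "\<And>n. h n \<le> 1" "\<And>n. \<bar>g n - h n\<bar> \<le> c" "y \<in> uspace X"
  shows "\<bar>tropical_combination d x g y - tropical_combination d x h y\<bar> \<le> c"
proof -
  have *: "tropical_combination d x g y - c \<le> tropical_combination d x h y"
    if "\<And>n. g n \<le> 1" "\<And>n. \<bar>g n - h n\<bar> \<le> c" for g h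
    unfolding tropical_combination_def[of d x h]
  proof (rule cINF_greatest)
    fix n
    have "tropical_combination d x g y \<le> d (x n) y + (1 - g n)"
      unfolding tropical_combination_def
      by (rule cINF_lower[OF bdd_below_tropical_combination]) (use that assms(4) in auto)
    with that(2)[of n] show "tropical_combination d x g y - c \<le> d (x n) y + (1 - h n)" by linarith
  qed simp
  have "\<bar>h n - g n\<bar> \<le> c" for n using assms(3)[of n] by (simp add: abs_minus_commute)
  from *[of g h] *[of h g, OF assms(2) this] assms(1,3) show ?thesis by (simp add: abs_le_iff)
qed

text \<open>The term at \<open>m\<close> gives the upper bound. For the lower bound, terms with
  \<open>g n > 0\<close> have \<open>x n\<close> within \<open>c\<close> of \<open>z\<close>, and
  terms with \<open>g n = 0\<close> are at least 1.\<close>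

lemma tropical_combination_near:
  assumes g: "\<And>n. g n \<le> 1" "\<And>n. 0 \<le> g n" "g m = 1" and y: "y \<in> uspace X"
    and z: "z \<in> uspace X" "\<And>n. 0 < g n \<Longrightarrow> d z (x n) \<le> c"
  shows "\<bar>tropical_combination d x g y - d z y\<bar> \<le> c"
proof -
  have near: "\<bar>d z y - d (x n) y\<bar> \<le> c" if "0 < g n" for n
    using uniform_pseudometric_diff_le[OF d z(1) x y, of n] z(2)[OF that] by linarith
  have "tropical_combination d x g y \<le> d (x m) y + (1 - g m)"
    unfolding tropical_combination_def
    by (rule cINF_lower[OF bdd_below_tropical_combination]) (use g y in auto)
  moreover have "d z y - c \<le> tropical_combination d x g y"
    unfolding tropical_combination_def
  proof (rule cINF_greatest)
    fix n
    have "0 \<le> d (x n) y" "d z y \<le> 1" using uniform_pseudometricD(1,2)[OF d] x y z by auto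
    moreover have "0 \<le> c" using near[of m] g(3) by simp
    ultimately show "d z y - c \<le> d (x n) y + (1 - g n)"
      using near[of n] g(1,2)[of n] by (cases "g n = 0") auto
  qed simp
  ultimately show ?thesis using near[of m] g(3) by simp
qed

end

section \<open>Neighborhood retractions in the test space\<close>

lemma uniformly_continuous_compose:
  assumes f: "uniformly_continuous X Y f" and g: "uniformly_continuous Y Z g"
  shows "uniformly_continuous X Z (g \<circ> f)"
proof (rule uniformly_continuousI)
  show "g \<circ> f \<in> uspace X \<rightarrow> uspace Z" using f g by (auto simp: uniformly_continuous_def)
  fix E assume "eventually E (entourages Z)"
  from uniformly_continuousD[OF f uniformly_continuousD[OF g this]]
  show "eventually (\<lambda>(x, y). E ((g \<circ> f) x, (g \<circ> f) y)) (entourages X)" by simp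
qed

lemma uniformly_continuous_into_subuniform:
  assumes f: "uniformly_continuous X Y f" and N: "f ` uspace X \<subseteq> N"
  shows "uniformly_continuous X (subuniform Y N) f"
proof (rule uniformly_continuousI)
  show "f \<in> uspace X \<rightarrow> uspace (subuniform Y N)" using f N by (auto simp: uniformly_continuous_def)
  fix E assume "eventually E (entourages (subuniform Y N))"
  then have "eventually (\<lambda>p. p \<in> N \<times> N \<longrightarrow> E p) (entourages Y)"
    by (simp add: eventually_inf_principal)
  from uniformly_continuousD[OF f this] eventually_entourages_carrier[of X]
  show "eventually (\<lambda>(x, y). E (f x, f y)) (entourages X)"
    by eventually_elim (use N in auto)
qed

lemma uniformly_continuous_subset:
  assumes f: "uniformly_continuous (subuniform Z N) X f" and M: "M \<subseteq> N"
  shows "uniformly_continuous (subuniform Z M) X f"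
proof (rule uniformly_continuousI)
  show "f \<in> uspace (subuniform Z M) \<rightarrow> uspace X" using f M by (auto simp: uniformly_continuous_def)
  fix E assume "eventually E (entourages X)"
  from uniformly_continuousD[OF f this] M
  show "eventually (\<lambda>(x, y). E (f x, f y)) (entourages (subuniform Z M))"
    by (auto simp: eventually_inf_principal elim!: eventually_mono)
qed

text \<open>The test space has the product uniformity over the pseudometrics and the uniformity of
  uniform convergence in the points \<open>y\<close>. A basic entourage involves finitely many
  \<open>d\<close>, so one \<open>d\<close> at a time suffices, uniformly in
  \<open>y\<close>.\<close>

lemma uniformly_continuous_into_test_space:
  assumes F: "F \<in> uspace Z \<rightarrow> test_carrier X"
    and cont: "\<And>d e. uniform_pseudometric X d \<Longrightarrow> 0 < e \<Longrightarrow>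
      eventually (\<lambda>(z, z'). \<forall>y\<in>uspace X. \<bar>F z (d, y) - F z' (d, y)\<bar> < e) (entourages Z)"
  shows "uniformly_continuous Z (test_space X) F"
proof (rule uniformly_continuousI)
  fix E assume "eventually E (entourages (test_space X))"
  then obtain D e where D: "finite D" "D \<subseteq> {d. uniform_pseudometric X d}" "0 < e"
    and E: "\<And>q r. \<lbrakk>q \<in> test_carrier X; r \<in> test_carrier X;
      \<forall>d\<in>D. \<forall>y\<in>uspace X. \<bar>q (d, y) - r (d, y)\<bar> < e\<rbrakk> \<Longrightarrow> E (q, r)"
    unfolding entourages_test_space eventually_test_entourages by blast
  have "eventually (\<lambda>p. \<forall>d\<in>D. \<forall>y\<in>uspace X. \<bar>F (fst p) (d, y) - F (snd p) (d, y)\<bar> < e) (entourages Z)"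
    by (rule eventually_ball_finite[OF D(1)]) (use cont D in \<open>auto simp: split_beta'\<close>)
  with eventually_entourages_carrier[of Z]
  show "eventually (\<lambda>(x, y). E (F x, F y)) (entourages Z)"
    by eventually_elim (use F in \<open>auto intro!: E\<close>)
qed (use F in simp)

lemma test_space_cont_coordinate:
  assumes F: "uniformly_continuous Z (test_space X) F" and d: "uniform_pseudometric X d" and "0 < e"
  shows "eventually (\<lambda>(z, z'). \<forall>y\<in>uspace X. \<bar>F z (d, y) - F z' (d, y)\<bar> < e) (entourages Z)"
proof -
  have "eventually (\<lambda>(q, r). \<forall>y\<in>uspace X. \<bar>q (d, y) - r (d, y)\<bar> < e) (entourages (test_space X))"
    unfolding entourages_test_space eventually_test_entourages
    by (intro exI[of _ "{d}"] exI[of _ e]) (use assms in auto)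
  from uniformly_continuousD[OF F this] show ?thesis by simp
qed

lemma test_carrier_in:
  "\<lbrakk>q \<in> test_carrier X; uniform_pseudometric X d; y \<in> uspace X\<rbrakk> \<Longrightarrow> q (d, y) \<in> {0..1}"
  by (auto simp: test_carrier_def PiE_iff)

text \<open>The straight-line homotopy in the cube, restricted to the index set so that its values
  are again extensional.\<close>

definition test_homotopy ::
    "'a uniform_structure \<Rightarrow> ('z \<Rightarrow> 'a test_point) \<Rightarrow> ('z \<Rightarrow> 'a test_point) \<Rightarrow> 'z \<times> real \<Rightarrow> 'a test_point"
  where "test_homotopy X F G = (\<lambda>(z, t). \<lambda>p\<in>{d. uniform_pseudometric X d} \<times> uspace X.
     (1 - t) * F z p + t * G z p)"

lemma uniformly_continuous_test_homotopy:
  assumes F: "uniformly_continuous Z (test_space X) F" and G: "uniformly_continuous Z (test_space X) G"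
  shows "uniformly_continuous (prod_uniform Z uniform_interval) (test_space X) (test_homotopy X F G)"
proof (rule uniformly_continuous_into_test_space)
  have int: "uspace uniform_interval = {0..1}" by (simp add: uniform_interval_def)
  have FG: "F z \<in> test_carrier X" "G z \<in> test_carrier X" if "z \<in> uspace Z" for z
    using F G that by (auto simp: uniformly_continuous_def)
  note FG' = FG[THEN test_carrier_in]
  show "test_homotopy X F G \<in> uspace (prod_uniform Z uniform_interval) \<rightarrow> test_carrier X"
  proof (clarsimp simp: int)
    fix z and t :: real assume z: "z \<in> uspace Z" and t: "0 \<le> t" "t \<le> 1"
    have "(1 - t) * F z (d, y) + t * G z (d, y) \<in> {0..1}"
      if "uniform_pseudometric X d" "y \<in> uspace X" for d y
      using FG'[OF z that] t convex_bound_le[of "F z (d, y)" 1 "G z (d, y)" "1 - t" t] by auto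
    then show "test_homotopy X F G (z, t) \<in> test_carrier X"
      by (auto simp: test_homotopy_def test_carrier_def)
  qed
  fix d and e :: real assume d: "uniform_pseudometric X d" and e: "0 < e"
  then have e3: "0 < e / 3" by simp
  let ?P = "\<lambda>p. case p of (z, z') \<Rightarrow> z \<in> uspace Z \<and> z' \<in> uspace Z \<and>
      (\<forall>y\<in>uspace X. \<bar>F z (d, y) - F z' (d, y)\<bar> < e / 3) \<and>
      (\<forall>y\<in>uspace X. \<bar>G z (d, y) - G z' (d, y)\<bar> < e / 3)"
  let ?Q = "\<lambda>p. case p of (s, t) \<Rightarrow> s \<in> {0..1} \<and> t \<in> {0..1} \<and> \<bar>s - t\<bar> < e / 3"
  have P: "eventually ?P (entourages Z)"
    using eventually_entourages_carrier[of Z] test_space_cont_coordinate[OF F d e3]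
      test_space_cont_coordinate[OF G d e3] by eventually_elim auto
  have Q: "eventually ?Q (entourages uniform_interval)"
    unfolding uniform_interval_def entourages_uniform_of_metric eventually_metric_entourages
    by (intro exI[of _ "e / 3"]) (use e in \<open>auto simp: dist_real_def\<close>)
  have main: "\<bar>test_homotopy X F G (z, s) (d, y) - test_homotopy X F G (z', t) (d, y)\<bar> < e"
    if z: "z \<in> uspace Z" "z' \<in> uspace Z"
      and *: "\<forall>y\<in>uspace X. \<bar>F z (d, y) - F z' (d, y)\<bar> < e / 3"
        "\<forall>y\<in>uspace X. \<bar>G z (d, y) - G z' (d, y)\<bar> < e / 3"
      and st: "0 \<le> s" "s \<le> 1" "\<bar>s - t\<bar> < e / 3" and y: "y \<in> uspace X" for z z' y and s t :: real
  proof -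
    define a a' b b' where "a = F z (d, y)" "a' = F z' (d, y)" "b = G z (d, y)" "b' = G z' (d, y)"
    note ab = this
    have r: "0 \<le> a'" "a' \<le> 1" "0 \<le> b'" "b' \<le> 1"
      using FG'[OF z(2) d y] by (auto simp: ab)
    \<comment> \<open>The change is split into those of \<open>F\<close>, of \<open>G\<close> and of
      the parameter; the last is at most \<open>\<bar>s - t\<bar>\<close> because \<open>a'\<close>
      and \<open>b'\<close> lie in the unit interval.\<close>
    have "(1 - s) * a + s * b - ((1 - t) * a' + t * b')
        = (1 - s) * (a - a') + s * (b - b') + (s - t) * (b' - a')" by algebra
    also have "\<bar>\<dots>\<bar> \<le> (1 - s) * \<bar>a - a'\<bar> + s * \<bar>b - b'\<bar> + \<bar>s - t\<bar> * \<bar>b' - a'\<bar>"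
      using st by (intro order_trans[OF abs_triangle_ineq] add_mono) (auto simp: abs_mult)
    also have "\<dots> \<le> (1 - s) * (e / 3) + s * (e / 3) + \<bar>s - t\<bar> * 1"
      using st r *(1)[rule_format, OF y] *(2)[rule_format, OF y]
      by (intro add_mono mult_left_mono) (auto simp: ab[symmetric])
    also have "\<dots> = e / 3 + \<bar>s - t\<bar>" by (simp add: field_simps)
    also have "\<dots> < e" using st(3) e by linarith
    finally show ?thesis using d y by (simp add: test_homotopy_def ab)
  qed
  show "eventually (\<lambda>(p, q). \<forall>y\<in>uspace X. \<bar>test_homotopy X F G p (d, y) - test_homotopy X F G q (d, y)\<bar> < e)
      (entourages (prod_uniform Z uniform_interval))"
    unfolding entourages_prod_uniform eventually_filtermap eventually_prod_filter
    by (intro exI[of _ ?P] exI[of _ ?Q] conjI P Q allI impI) (clarify, rule main, auto)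
qed

text \<open>The Kuratowski embedding, made for all bounded uniform pseudometrics at once.\<close>

definition test_embedding :: "'a uniform_structure \<Rightarrow> 'a \<Rightarrow> 'a test_point" where
  "test_embedding X x = (\<lambda>(d, y)\<in>{d. uniform_pseudometric X d} \<times> uspace X. d x y)"

lemma test_embedding_apply [simp]:
  "uniform_pseudometric X d \<Longrightarrow> y \<in> uspace X \<Longrightarrow> test_embedding X x (d, y) = d x y"
  by (simp add: test_embedding_def)

lemma test_embedding_in: "x \<in> uspace X \<Longrightarrow> test_embedding X x \<in> test_carrier X"
  by (auto simp: test_embedding_def test_carrier_def dest: uniform_pseudometricD(1,2))

lemma uniformly_continuous_test_embedding:
  "uniformly_continuous X (test_space X) (test_embedding X)"
proof (rule uniformly_continuous_into_test_space)
  fix d and e :: real assume d: "uniform_pseudometric X d" and e: "0 < e"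
  from eventually_entourages_carrier[of X] uniform_pseudometricD(6)[OF d e]
  show "eventually (\<lambda>(z, z'). \<forall>y\<in>uspace X. \<bar>test_embedding X z (d, y) - test_embedding X z' (d, y)\<bar> < e)
      (entourages X)"
  proof eventually_elim
    case (elim p)
    then show ?case using uniform_pseudometric_diff_le[OF d, of "fst p" "snd p"] d
      by (fastforce simp: split_beta')
  qed
qed (simp add: test_embedding_in)

text \<open>At the coordinate \<open>(d, y)\<close> the images of \<open>x\<close> and
  \<open>y\<close> differ by exactly \<open>d x y\<close>, and \<open>d\<close> can be chosen with
  its \<open>1/2\<close>-balls inside \<open>E\<close>. This yields both injectivity and the uniform
  continuity of the inverse.\<close>

lemma test_embedding_reflects:
  assumes "eventually E (entourages X)"
  obtains d where "uniform_pseudometric X d"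
    "\<And>x y. \<lbrakk>x \<in> uspace X; y \<in> uspace X;
      \<bar>test_embedding X x (d, y) - test_embedding X y (d, y)\<bar> < 1/2\<rbrakk> \<Longrightarrow> E (x, y)"
proof -
  obtain d where d: "uniform_pseudometric X d"
    "\<And>(n::nat) x y. x \<in> uspace X \<Longrightarrow> y \<in> uspace X \<Longrightarrow> d x y < 1 / 2 ^ Suc n \<Longrightarrow> E (x, y)"
    using uniform_pseudometric_exists[of "\<lambda>_::nat. E" X, OF assms] by metis
  show ?thesis
  proof (rule that[OF d(1)])
    fix x y assume *: "x \<in> uspace X" "y \<in> uspace X"
      "\<bar>test_embedding X x (d, y) - test_embedding X y (d, y)\<bar> < 1/2"
    then show "E (x, y)" using d(2)[of x y 0] uniform_pseudometricD(4)[OF d(1)] d(1) by simp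
  qed
qed

lemma inj_on_test_embedding:
  assumes "Hausdorff_space (utopology X)"
  shows "inj_on (test_embedding X) (uspace X)"
proof (rule inj_onI, rule ccontr)
  fix x y assume x: "x \<in> uspace X" "y \<in> uspace X" "test_embedding X x = test_embedding X y" "x \<noteq> y"
  then obtain U V where U: "openin (utopology X) U" "x \<in> U" "y \<in> V" "disjnt U V"
    using assms unfolding Hausdorff_space_def topspace_utopology by blast
  then have "eventually (\<lambda>(u, v). u = x \<longrightarrow> v \<in> U) (entourages X)"
    by (auto simp: openin_utopology)
  then obtain d where
    "\<And>u v. \<lbrakk>u \<in> uspace X; v \<in> uspace X;
      \<bar>test_embedding X u (d, v) - test_embedding X v (d, v)\<bar> < 1/2\<rbrakk>
      \<Longrightarrow> case (u, v) of (u, v) \<Rightarrow> u = x \<longrightarrow> v \<in> U"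
    by (rule test_embedding_reflects) blast
  from this[of x y] x U show False by (auto simp: disjnt_def)
qed

text \<open>A basic uniform neighborhood of the embedded copy of \<open>X\<close>, since
  \<open>d x y\<close> is the coordinate of the image of \<open>x\<close> at
  \<open>(d, y)\<close>.\<close>

definition test_neighborhood ::
    "'a uniform_structure \<Rightarrow> ('a \<Rightarrow> 'a \<Rightarrow> real) set \<Rightarrow> real \<Rightarrow> 'a test_point set" where
  "test_neighborhood X D e = {q \<in> test_carrier X.
     \<exists>x\<in>uspace X. \<forall>d\<in>D. \<forall>y\<in>uspace X. \<bar>d x y - q (d, y)\<bar> < e}"

text \<open>The inverse of the embedding is uniformly continuous on the image, so it extends to some
  \<open>r\<close> on a uniform neighborhood \<open>N\<close>. Both the cover witnessing
  \<open>N\<close> and the closeness \<open>E\<close> of values of \<open>r\<close> need one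
  entourage only, hence finitely many pseudometrics.\<close>

lemma ANRU_retraction:
  assumes X: "ANRU X" and E: "eventually E (entourages X)"
  obtains D e r where "finite D" "D \<subseteq> {d. uniform_pseudometric X d}" "0 < e"
    "uniformly_continuous (subuniform (test_space X) (test_neighborhood X D e)) X r"
    "\<And>x. x \<in> uspace X \<Longrightarrow> r (test_embedding X x) = x"
    "\<And>x q. \<lbrakk>x \<in> uspace X; q \<in> test_carrier X; \<forall>d\<in>D. \<forall>y\<in>uspace X. \<bar>d x y - q (d, y)\<bar> < e\<rbrakk>
      \<Longrightarrow> E (x, r q)"
proof -
  let ?i = "test_embedding X" and ?Q = "test_space X"
  let ?B = "?i ` uspace X"
  define j where "j = inv_into (uspace X) ?i"
  have ji: "j (?i x) = x" if "x \<in> uspace X" for x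
    using inj_on_test_embedding[of X] X that by (simp add: j_def ANRU_def)
  have B: "?B \<subseteq> uspace ?Q" using test_embedding_in by auto
  have "uniformly_continuous (subuniform ?Q ?B) X j"
  proof (rule uniformly_continuousI)
    show "j \<in> uspace (subuniform ?Q ?B) \<rightarrow> uspace X" using ji by auto
    fix E' assume "eventually E' (entourages X)"
    then obtain d where d: "uniform_pseudometric X d" "\<And>x y. \<lbrakk>x \<in> uspace X; y \<in> uspace X;
      \<bar>?i x (d, y) - ?i y (d, y)\<bar> < 1/2\<rbrakk> \<Longrightarrow> E' (x, y)" by (rule test_embedding_reflects) auto
    have "eventually (\<lambda>(q, r). \<forall>y\<in>uspace X. \<bar>q (d, y) - r (d, y)\<bar> < 1/2) (entourages ?Q)"
      unfolding entourages_test_space eventually_test_entourages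
      by (intro exI[of _ "{d}"] exI[of _ "1/2"]) (use d in auto)
    then show "eventually (\<lambda>(x, y). E' (j x, j y)) (entourages (subuniform ?Q ?B))"
      unfolding entourages_subuniform eventually_inf_principal
    proof eventually_elim
      case (elim p)
      show ?case
      proof (cases p, clarsimp simp: ji)
        fix x y assume "p = (?i x, ?i y)" "x \<in> uspace X" "y \<in> uspace X"
        with elim show "E' (x, y)" by (auto intro!: d(2))
      qed
    qed
  qed
  from ANRU_extends[OF X B this] obtain N r where N: "uniform_neighborhood ?Q ?B N"
    and r: "uniformly_continuous (subuniform ?Q N) X r" and rj: "\<And>b. b \<in> ?B \<Longrightarrow> r b = j b"
    unfolding extends_to_uniform_neighborhood_def by blast
  have ri: "r (?i x) = x" if "x \<in> uspace X" for x using rj ji that by auto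
  obtain V E1 where V: "star ?B V \<subseteq> N" and E1: "eventually E1 (entourages ?Q)"
    "\<And>q. q \<in> uspace ?Q \<Longrightarrow> \<exists>U\<in>V. {q' \<in> uspace ?Q. E1 (q, q')} \<subseteq> U"
    using N unfolding uniform_neighborhood_def uniform_cover_def by auto
  have "eventually (\<lambda>p. p \<in> N \<times> N \<longrightarrow> (case p of (q, q') \<Rightarrow> E (r q, r q'))) (entourages ?Q)"
    using uniformly_continuousD[OF r E] by (simp add: eventually_inf_principal)
  from eventually_conj[OF E1(1) this] obtain D e where
    D: "finite D" "D \<subseteq> {d. uniform_pseudometric X d}" "0 < e"
    and close: "\<And>q q'. \<lbrakk>q \<in> test_carrier X; q' \<in> test_carrier X;
      \<forall>d\<in>D. \<forall>y\<in>uspace X. \<bar>q (d, y) - q' (d, y)\<bar> < e\<rbrakk> \<Longrightarrow>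
      E1 (q, q') \<and> (q \<in> N \<longrightarrow> q' \<in> N \<longrightarrow> E (r q, r q'))"
    unfolding entourages_test_space eventually_test_entourages by force
  have near: "q \<in> N \<and> E (x, r q)" if x: "x \<in> uspace X" and q: "q \<in> test_carrier X"
    and c: "\<forall>d\<in>D. \<forall>y\<in>uspace X. \<bar>d x y - q (d, y)\<bar> < e" for x q
  proof -
    have i: "?i x \<in> test_carrier X" using x by (rule test_embedding_in)
    have "\<forall>d\<in>D. \<forall>y\<in>uspace X. \<bar>?i x (d, y) - q (d, y)\<bar> < e" using c D(2) by auto
    note cl = close[OF i q this]
    \<comment> \<open>The point \<open>q\<close> shares a member of the cover with the image of
      \<open>x\<close>, so it lies in the star of the image.\<close>
    obtain U where U: "U \<in> V" "{q' \<in> uspace ?Q. E1 (?i x, q')} \<subseteq> U" using E1(2) i by auto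
    have "?i x \<in> U" "q \<in> U" using U(2) cl q i entourage_refl[OF E1(1), of "?i x"] by auto
    then have "?i x \<in> N" "q \<in> N" using V U(1) x unfolding star_def by blast+
    with cl ri[OF x] show ?thesis by simp
  qed
  have "test_neighborhood X D e \<subseteq> N" using near by (auto simp: test_neighborhood_def)
  from uniformly_continuous_subset[OF r this] D ri near show ?thesis by (intro that) auto
qed

section \<open>Domination by the realization of a countable complex\<close>

lemma uspace_poset_realization [simp]: "uspace (poset_realization P) = realization_points P"
  using realization_points_subset[of P] by (auto simp: poset_realization_def)

lemma eventually_poset_realization:
  "eventually E (entourages (poset_realization P)) \<longleftrightarrow>
    (\<exists>e>0. \<forall>g\<in>realization_points P. \<forall>h\<in>realization_points P. cube_dist P g h < e \<longrightarrow> E (g, h))"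
  using realization_points_subset[of P]
  unfolding poset_realization_def entourages_uniform_of_metric eventually_metric_entourages
  by (simp add: Int_absorb1 Int_absorb2)

theorem theorem9p7:
  fixes X :: "'a uniform_structure" and C :: "'a set set"
  assumes "ANRU X"
    and "separable_space (utopology X)"
    and "uniform_cover X C"
  shows "\<exists>K :: nat set set. abstract_simplicial_complex K \<and> countable K \<and>
           uniformly_homotopy_dominated C X (poset_realization K)"
proof (cases "uspace X = {}")
  \<comment> \<open>An empty space has no dense sequence. Its entourage filter is trivial, and the
    empty complex with empty realization serves.\<close>
  case True
  have "eventually (\<lambda>_. False) (entourages X)"
    using eventually_entourages_carrier[of X] by (rule eventually_mono) (auto simp: True)
  then have ev: "eventually P (entourages X)" for P by (rule eventually_mono) simp
  have "eventually P (entourages (prod_uniform X uniform_interval))" for P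
    using eventually_entourages_carrier[of "prod_uniform X uniform_interval"]
    by (rule eventually_mono) (auto simp: True)
  moreover have rp: "realization_points ({} :: nat set set) = {}"
    by (auto simp: realization_points_def)
  ultimately have "uniformly_homotopy_dominated C X (poset_realization ({} :: nat set set))"
    unfolding uniformly_homotopy_dominated_def
    by (intro exI[of _ "\<lambda>_. undefined"] exI[of _ "\<lambda>_. undefined"] conjI uniformly_continuousI)
      (auto simp: True ev eventually_poset_realization rp intro: exI[of _ 1])
  then show ?thesis
    by (intro exI[of _ "{}"]) (simp add: abstract_simplicial_complex_def)
next
  case ne: False

  \<comment> \<open>Retraction, dominating pseudometric and Lipschitz family\<close>
  obtain E where E: "eventually E (entourages X)"
    "\<And>x. x \<in> uspace X \<Longrightarrow> \<exists>U\<in>C. {y \<in> uspace X. E (x, y)} \<subseteq> U"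
    using assms(3) by (auto simp: uniform_cover_def)
  obtain D e r where D: "finite D" "D \<subseteq> {d. uniform_pseudometric X d}" "0 < e"
    and r: "uniformly_continuous (subuniform (test_space X) (test_neighborhood X D e)) X r"
      "\<And>x. x \<in> uspace X \<Longrightarrow> r (test_embedding X x) = x"
      "\<And>x q. \<lbrakk>x \<in> uspace X; q \<in> test_carrier X; \<forall>d\<in>D. \<forall>y\<in>uspace X. \<bar>d x y - q (d, y)\<bar> < e\<rbrakk>
        \<Longrightarrow> E (x, r q)"
    using ANRU_retraction[OF assms(1) E(1)] by blast
  let ?N = "test_neighborhood X D e" and ?i = "test_embedding X"
  \<comment> \<open>Halving \<open>e\<close> turns the non-strict bounds obtained later into the
    strict ones of \<open>test_neighborhood\<close>.\<close>
  have "eventually (\<lambda>p. \<forall>d\<in>D. d (fst p) (snd p) < e / 2) (entourages X)"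
    by (rule eventually_ball_finite[OF D(1)])
      (use D uniform_pseudometricD(6)[where e = "e / 2"] in \<open>auto simp: split_beta'\<close>)
  \<comment> \<open>A single \<open>d0\<close> controls all of \<open>D\<close>: the constant
    sequence of entourages, read at index 0, gives the radius \<open>1/2\<close>.\<close>
  from uniform_pseudometric_exists[of "\<lambda>_::nat. _" X, OF this] obtain d0
    where d0: "uniform_pseudometric X d0"
      and "\<And>(n::nat) x y. \<lbrakk>x \<in> uspace X; y \<in> uspace X; d0 x y < 1 / 2 ^ Suc n\<rbrakk>
        \<Longrightarrow> \<forall>d\<in>D. d (fst (x, y)) (snd (x, y)) < e / 2"
    by blast
  from this(2)[of _ _ 0] have dom: "d x y \<le> e / 2"
    if "x \<in> uspace X" "y \<in> uspace X" "d0 x y < 1/2" "d \<in> D" for x y d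
    using that by fastforce
  note d0D = uniform_pseudometricD[OF d0]
  obtain x :: "nat \<Rightarrow> 'a" where x: "\<And>n. x n \<in> uspace X"
    and dense: "\<And>d z e. \<lbrakk>uniform_pseudometric X d; z \<in> uspace X; 0 < e\<rbrakk> \<Longrightarrow> \<exists>n. d z (x n) < e"
    using separable_dense_sequence[OF assms(2) ne] by blast
  \<comment> \<open>The supports have radius \<open>3 * (1/12) = 1/4\<close>, so two centers whose
    functions are positive at one point are less than \<open>1/2\<close> apart, as
    \<open>dom\<close> requires.\<close>
  have e12: "0 < (1/12 :: real)" by simp
  have dn: "\<exists>n. d0 z (x n) < 1/12" if "z \<in> uspace X" for z
    using dense[OF d0 that, of "1/12"] by simp
  obtain f :: "nat \<Rightarrow> 'a \<Rightarrow> real" where f01: "\<And>n z. 0 \<le> f n z" "\<And>n z. f n z \<le> 1"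
    and flip: "\<And>n y z. y \<in> uspace X \<Longrightarrow> z \<in> uspace X \<Longrightarrow> \<bar>f n y - f n z\<bar> \<le> d0 y z / (1/12)"
    and fsupp: "\<And>n z. 0 < f n z \<Longrightarrow> d0 z (x n) < 3 * (1/12)"
    and ffin: "\<And>z. z \<in> uspace X \<Longrightarrow> finite {n. 0 < f n z}"
    and f1: "\<And>z. z \<in> uspace X \<Longrightarrow> \<exists>n. f n z = 1"
    using point_finite_lipschitz_family[OF d0 x e12 dn] by blast

  \<comment> \<open>The Vietoris-Rips complex on the indices of the sequence\<close>
  define K where "K = {\<sigma> :: nat set. finite \<sigma> \<and> \<sigma> \<noteq> {} \<and>
    (\<forall>m\<in>\<sigma>. \<forall>n\<in>\<sigma>. \<forall>d\<in>D. d (x m) (x n) \<le> e / 2)}"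
  have K: "abstract_simplicial_complex K"
    unfolding abstract_simplicial_complex_def
  proof (intro ballI conjI allI impI)
    fix \<sigma> \<tau> assume "\<sigma> \<in> K" "\<tau> \<subseteq> \<sigma> \<and> \<tau> \<noteq> {}"
    then show "\<tau> \<in> K" unfolding K_def using finite_subset by blast
  qed (auto simp: K_def)
  have "countable K"
    by (rule countable_subset[OF _ countable_Collect_finite]) (auto simp: K_def)
  have vK: "{n} \<in> K" for n
  proof -
    have "d (x n) (x n) = 0" if "d \<in> D" for d
      using uniform_pseudometricD(4)[OF _ x] D(2) that by blast
    then have "\<forall>d\<in>D. d (x n) (x n) \<le> e / 2" using D(3) by fastforce
    then show ?thesis by (simp add: K_def)
  qed
  let ?R = "realization_points K"
  have g01: "0 \<le> g {n}" "g {n} \<le> 1" if "g \<in> ?R" for g n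
  proof -
    have "g {n} \<in> {0..1}"
      using that realization_points_subset[of K] vK[of n] unfolding cube_def by blast
    then show "0 \<le> g {n}" "g {n} \<le> 1" by auto
  qed

  \<comment> \<open>The map \<open>u\<close> into the realization\<close>
  define u where "u z = (\<lambda>\<sigma>\<in>K. Min ((\<lambda>n. f n z) ` \<sigma>))" for z
  have uv: "u z {n} = f n z" for z n using vK by (simp add: u_def)
  have uR: "u z \<in> ?R" if z: "z \<in> uspace X" for z
  proof -
    obtain n where n: "f n z = 1" using f1[OF z] by blast
    have "d0 (x m) (x k) < 1/2" if "0 < f m z" "0 < f k z" for m k
      using fsupp[OF that(1)] fsupp[OF that(2)] d0D(5)[OF x z x, of m k] d0D(3)[OF x z, of m]
      by simp
    then have "{m. 0 < f m z} \<in> K"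
      using ffin[OF z] n dom x by (auto simp: K_def intro!: exI[of _ n])
    then show ?thesis unfolding u_def using f01 n
      by (intro Min_in_realization_points[OF K]) auto
  qed
  have u: "uniformly_continuous X (poset_realization K) u"
  proof (rule uniformly_continuousI)
    fix E' assume "eventually E' (entourages (poset_realization K))"
    then obtain \<epsilon> where \<epsilon>: "0 < \<epsilon>" "\<And>g h. \<lbrakk>g \<in> ?R; h \<in> ?R; cube_dist K g h < \<epsilon>\<rbrakk> \<Longrightarrow> E' (g, h)"
      unfolding eventually_poset_realization by blast
    \<comment> \<open>The constant \<open>12 = 1 / (1/12)\<close> of the family passes to the
      minimum over every simplex, whatever its dimension.\<close>
    have lip: "cube_dist K (u y) (u z) \<le> 12 * d0 y z" if "y \<in> uspace X" "z \<in> uspace X" for y z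
    proof -
      have "(SUP \<sigma>\<in>K. \<bar>u y \<sigma> - u z \<sigma>\<bar>) \<le> 12 * d0 y z"
      proof (rule cSUP_least)
        fix \<sigma> assume \<sigma>: "\<sigma> \<in> K"
        then have "\<bar>Min ((\<lambda>n. f n y) ` \<sigma>) - Min ((\<lambda>n. f n z) ` \<sigma>)\<bar> \<le> 12 * d0 y z"
          using flip[OF that] by (intro abs_Min_diff_le) (auto simp: K_def mult.commute)
        with \<sigma> show "\<bar>u y \<sigma> - u z \<sigma>\<bar> \<le> 12 * d0 y z" by (simp add: u_def)
      qed (use vK in auto)
      moreover have "u y \<in> cube K" "u z \<in> cube K"
        using uR that realization_points_subset by blast+
      ultimately show ?thesis using vK by (auto simp: cube_dist_def)
    qed
    have "0 < \<epsilon> / 12" using \<epsilon>(1) by simp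
    from d0D(6)[OF this] eventually_entourages_carrier[of X]
    show "eventually (\<lambda>(y, z). E' (u y, u z)) (entourages X)"
    proof eventually_elim
      case (elim p)
      then show ?case using lip[of "fst p" "snd p"] by (auto intro!: \<epsilon>(2) uR)
    qed
  qed (use uR in auto)

  \<comment> \<open>The tropical map \<open>\<phi>\<close> from the realization to the test
    space\<close>
  define \<phi> where "\<phi> g = (\<lambda>(d, y)\<in>{d. uniform_pseudometric X d} \<times> uspace X.
    tropical_combination d x (\<lambda>n. g {n}) y)" for g
  have \<phi>_apply: "\<phi> g (d, y) = tropical_combination d x (\<lambda>n. g {n}) y"
    if "uniform_pseudometric X d" "y \<in> uspace X" for g d y
    using that by (simp add: \<phi>_def)
  have vertex: "\<exists>n. g {n} = 1" if "g \<in> ?R" for g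
    using realization_points_simplex(1)[OF K that] by blast
  have \<phi>_in: "\<phi> g \<in> test_carrier X" if g: "g \<in> ?R" for g
  proof -
    obtain m where m: "g {m} = 1" using vertex[OF g] by blast
    have "tropical_combination d x (\<lambda>n. g {n}) y \<in> {0..1}"
      if "uniform_pseudometric X d" "y \<in> uspace X" for d y
      using g01[OF g] m that by (intro tropical_combination_in[OF _ x]) auto
    then show ?thesis by (auto simp: \<phi>_def test_carrier_def)
  qed
  \<comment> \<open>This is applied twice: with \<open>z\<close> a vertex of value 1, to see that
    \<open>\<phi> g\<close> lies in the neighborhood, and with \<open>g = u z\<close>, to control
    the homotopy.\<close>
  have near: "\<bar>d z y - \<phi> g (d, y)\<bar> \<le> e / 2"
    if g: "g \<in> ?R" and z: "z \<in> uspace X" "\<And>n d. 0 < g {n} \<Longrightarrow> d \<in> D \<Longrightarrow> d z (x n) \<le> e / 2"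
      and d: "d \<in> D" and y: "y \<in> uspace X" for g z d y
  proof -
    obtain m where m: "g {m} = 1" using vertex[OF g] by blast
    have d': "uniform_pseudometric X d" using d D by auto
    have "\<bar>tropical_combination d x (\<lambda>n. g {n}) y - d z y\<bar> \<le> e / 2"
      using g01[OF g] m z d y by (intro tropical_combination_near[OF d' x]) auto
    then show ?thesis using d' y by (simp add: \<phi>_apply abs_minus_commute)
  qed
  have \<phi>_N: "\<phi> g \<in> ?N" if g: "g \<in> ?R" for g
  proof -
    obtain m where m: "g {m} = 1" using vertex[OF g] by blast
    have "d (x m) (x n) \<le> e / 2" if "0 < g {n}" "d \<in> D" for n d
    proof -
      \<comment> \<open>Every vertex of positive value spans an edge with \<open>m\<close>, and
        edges of \<open>K\<close> are short for all \<open>d\<close> in \<open>D\<close>.\<close>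
      have "{m, n} \<in> K" using realization_points_simplex(2)[OF K g vK vK] m that by simp
      then show ?thesis using that by (auto simp: K_def)
    qed
    then have "\<bar>d (x m) y - \<phi> g (d, y)\<bar> \<le> e / 2" if "d \<in> D" "y \<in> uspace X" for d y
      using near[OF g x[of m] _ that] by blast
    then have "\<bar>d (x m) y - \<phi> g (d, y)\<bar> < e" if "d \<in> D" "y \<in> uspace X" for d y
      using that D(3) by fastforce
    then show ?thesis
      unfolding test_neighborhood_def using \<phi>_in[OF g] x[of m] by blast
  qed
  have \<phi>: "uniformly_continuous (poset_realization K) (test_space X) \<phi>"
  proof (rule uniformly_continuous_into_test_space)
    fix d and \<epsilon> :: real assume d: "uniform_pseudometric X d" and \<epsilon>: "0 < \<epsilon>"
    \<comment> \<open>Vertex values are coordinates of the cube, so \<open>\<phi>\<close> is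
      1-Lipschitz in each coordinate, also for \<open>d\<close> outside \<open>D\<close>.\<close>
    have "\<bar>\<phi> g (d, y) - \<phi> h (d, y)\<bar> \<le> cube_dist K g h"
      if "g \<in> ?R" "h \<in> ?R" "y \<in> uspace X" for g h y
      unfolding \<phi>_apply[OF d that(3)]
      using that g01 realization_points_subset[of K] vK
      by (intro tropical_combination_diff_le[OF d x] cube_dist_upper) auto
    with \<epsilon> show "eventually (\<lambda>(g, h). \<forall>y\<in>uspace X. \<bar>\<phi> g (d, y) - \<phi> h (d, y)\<bar> < \<epsilon>)
        (entourages (poset_realization K))"
      unfolding eventually_poset_realization by (fastforce intro!: exI[of _ \<epsilon>])
  qed (use \<phi>_in in auto)

  \<comment> \<open>The homotopy and its size\<close>
  let ?h = "test_homotopy X (\<phi> \<circ> u) ?i"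
  have h: "uniformly_continuous (prod_uniform X uniform_interval) (test_space X) ?h"
    by (intro uniformly_continuous_test_homotopy uniformly_continuous_test_embedding
        uniformly_continuous_compose[OF u \<phi>])
  have I: "uspace uniform_interval = {0..1}" by (simp add: uniform_interval_def)
  have h_in: "?h (z, t) \<in> test_carrier X" if "z \<in> uspace X" "t \<in> {0..1}" for z t
    using h that I by (auto simp: uniformly_continuous_def)
  have h_near: "\<bar>d z y - ?h (z, t) (d, y)\<bar> < e"
    if z: "z \<in> uspace X" and t: "t \<in> {0..1}" and d: "d \<in> D" and y: "y \<in> uspace X" for z t d y
  proof -
    have "d z (x n) \<le> e / 2" if "0 < u z {n}" "d \<in> D" for n d
      using fsupp[of n z] that dom[OF z x] by (simp add: uv)
    from near[OF uR[OF z] z _ d y] this have "\<bar>d z y - \<phi> (u z) (d, y)\<bar> \<le> e / 2" by blast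
    then have "(1 - t) * \<bar>d z y - \<phi> (u z) (d, y)\<bar> \<le> 1 * (e / 2)"
      using t by (intro mult_mono) auto
    \<comment> \<open>The segment ends at the image of \<open>z\<close>, so the deviation from it
      shrinks by the factor \<open>1 - t\<close>; thus \<open>z\<close> witnesses that the whole
      segment stays in \<open>?N\<close>.\<close>
    moreover have "d z y - ?h (z, t) (d, y) = (1 - t) * (d z y - \<phi> (u z) (d, y))"
      using d D(2) y by (auto simp: test_homotopy_def algebra_simps)
    ultimately show ?thesis using t D(3) by (simp add: abs_mult)
  qed
  have h_N: "?h ` uspace (prod_uniform X uniform_interval) \<subseteq> ?N"
  proof (clarsimp simp: I)
    fix z and t :: real assume z: "z \<in> uspace X" and "0 \<le> t" "t \<le> 1"
    then have t: "t \<in> {0..1}" by simp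
    show "?h (z, t) \<in> ?N"
      unfolding test_neighborhood_def using h_in[OF z t] h_near[OF z t] z by blast
  qed
  have ends: "?h (z, 0) = \<phi> (u z)" "?h (z, 1) = ?i z" for z
    by (auto simp: test_homotopy_def \<phi>_def test_embedding_def fun_eq_iff restrict_def)
  have v: "uniformly_continuous (poset_realization K) X (r \<circ> \<phi>)"
    using \<phi>_N by (intro uniformly_continuous_compose[OF _ r(1)]
        uniformly_continuous_into_subuniform[OF \<phi>]) auto
  have H: "uniformly_continuous (prod_uniform X uniform_interval) X (r \<circ> ?h)"
    by (rule uniformly_continuous_compose[OF uniformly_continuous_into_subuniform[OF h h_N] r(1)])
  have "\<exists>U\<in>C. (r \<circ> ?h) ` ({z} \<times> {0..1}) \<subseteq> U" if z: "z \<in> uspace X" for z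
  proof -
    obtain U where U: "U \<in> C" "{y \<in> uspace X. E (z, y)} \<subseteq> U" using E(2)[OF z] by blast
    have "r (?h (z, t)) \<in> U" if t: "t \<in> {0..1}" for t
    proof -
      \<comment> \<open>The whole track stays \<open>E\<close>-close to \<open>z\<close>, and
        \<open>U\<close> was chosen to contain everything \<open>E\<close>-close to
        \<open>z\<close>.\<close>
      have "E (z, r (?h (z, t)))" by (rule r(3)[OF z h_in[OF z t]]) (use h_near[OF z t] in blast)
      moreover have "r (?h (z, t)) \<in> uspace X"
        using H z t I by (auto simp: uniformly_continuous_def)
      ultimately show ?thesis using U by blast
    qed
    then have "(r \<circ> ?h) ` ({z} \<times> {0..1}) \<subseteq> U" by auto
    with U(1) show ?thesis by blast
  qed
  with u v H r(2) ends have "uniformly_homotopy_dominated C X (poset_realization K)"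
    unfolding uniformly_homotopy_dominated_def
    by (intro exI[of _ u] exI[of _ "r \<circ> \<phi>"] exI[of _ "r \<circ> ?h"]) simp
  with K \<open>countable K\<close> show ?thesis by blast
qed

end
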